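(* Fix $\gamma>0$ and $\kappa\ge1$, and suppose that $P$ is a probability measure on $\mathbb S_{++}^d$ supported on covariance matrices with eigenvalues in $[1/\sqrt\kappa,\sqrt\kappa]$. Let $\Sigma^\star$ be the minimizer of $F_\gamma$. If Riemannian gradient descent for $F_\gamma$ is initialized at a point $\Sigma_0\in\operatorname{supp}P$ and run with step size $\eta=\frac{2}{(2+\gamma)^4\,\kappa}$, then for any $T\ge1$, $$F_\gamma(\Sigma_T)-F_\gamma(\Sigma^\star)\le\exp\Bigl(-\frac{4T}{(2+\gamma)^{20}\,\kappa^5}\Bigr)\,\{F_\gamma(\Sigma_0)-F_\gamma(\Sigma^\star)\}.$$
   Context: $\mathbb S_{++}^d$ is the set of real symmetric positive definite $d\times d$ matrices, identified with non-degenerate centered Gaussians on $\mathbb R^d$. For $\Sigma,\Sigma'\in\mathbb S_{++}^d$, $W_2^2(\Sigma,\Sigma')=\operatorname{tr}[\Sigma+\Sigma'-2(\Sigma^{1/2}\Sigma'\Sigma^{1/2})^{1/2}]$ is the squared $2$-Wasserstein distance between $\mathcal N(0,\Sigma)$ and $\mathcal N(0,\Sigma')$, and $\mathrm{KL}(\Sigma\,\|\,I_d)=\frac12\operatorname{tr}\Sigma-\frac12\ln\det\Sigma-\frac d2$ is the Kullback--Leibler divergence of $\mathcal N(0,\Sigma)$ from $\mathcal N(0,I_d)$. The entropically-regularized barycenter functional is $$F_\gamma(\Sigma)=\frac12\int W_2^2(\Sigma,\Sigma')\,dP(\Sigma')+\gamma\,\mathrm{KL}(\Sigma\,\|\,I_d),$$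 and $\Sigma^\star$ is its (unique) minimizer over $\mathbb S_{++}^d$. The matrix geometric mean is $\mathrm{GM}(A,B)=A^{1/2}(A^{-1/2}BA^{-1/2})^{1/2}A^{1/2}$. Riemannian gradient descent for $F_\gamma$ with step size $\eta$: for $t\ge1$, $\Sigma_t=S_t\Sigma_{t-1}S_t$ with $$S_t=\eta\int\mathrm{GM}(\Sigma_{t-1}^{-1},\Sigma)\,dP(\Sigma)+\eta\gamma\,\Sigma_{t-1}^{-1}+(1-\eta(1+\gamma))\,I_d .$$ *)

theory Defs
  imports "HOL-Probability.Probability"
begin

definition psd :: "real^'n^'n \<Rightarrow> bool" where
  "psd A \<longleftrightarrow> transpose A = A \<and> (\<forall>x. 0 \<le> x \<bullet> (A *v x))"

definition SPD :: "(real^'n^'n) set" where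
  "SPD = {A. transpose A = A \<and> (\<forall>x. x \<noteq> 0 \<longrightarrow> 0 < x \<bullet> (A *v x))}"

definition eigenvalue :: "real^'n^'n \<Rightarrow> real \<Rightarrow> bool" where
  "eigenvalue A l \<longleftrightarrow> (\<exists>v. v \<noteq> 0 \<and> A *v v = l *\<^sub>R v)"

(* Principal square root: unique for positive semidefinite A, unspecified otherwise. *)
definition msqrt :: "real^'n^'n \<Rightarrow> real^'n^'n" where
  "msqrt A = (THE B. psd B \<and> B ** B = A)"

definition GM :: "real^'n^'n \<Rightarrow> real^'n^'n \<Rightarrow> real^'n^'n" where
  "GM A B =
     (let R = msqrt A; R' = matrix_inv (msqrt A)
      in R ** msqrt (R' ** B ** R') ** R)"

(* Squared 2-Wasserstein distance between N(0,A) and N(0,B). *)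
definition W2_sq :: "real^'n^'n \<Rightarrow> real^'n^'n \<Rightarrow> real" where
  "W2_sq A B = trace (A + B - 2 *\<^sub>R msqrt (msqrt A ** B ** msqrt A))"

(* KL divergence of N(0,A) from the standard Gaussian N(0,I). *)
definition KL_std :: "real^'n^'n \<Rightarrow> real" where
  "KL_std A = trace A / 2 - ln (det A) / 2 - real CARD('n) / 2"

definition barycenter_functional ::
    "(real^'n^'n) measure \<Rightarrow> real \<Rightarrow> real^'n^'n \<Rightarrow> real" where
  "barycenter_functional P \<gamma> A = (1/2) * (\<integral>B. W2_sq A B \<partial>P) + \<gamma> * KL_std A"

(* Topological support, relative to the subspace topology on space M. *)
definition measure_support :: "('a::topological_space) measure \<Rightarrow> 'a set" where
  "measure_support M = {x \<in> space M. \<forall>U. open U \<and> x \<in> U \<longrightarrow> 0 < emeasure M (U \<inter> space M)}"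

definition rgd_factor ::
    "(real^'n^'n) measure \<Rightarrow> real \<Rightarrow> real \<Rightarrow> real^'n^'n \<Rightarrow> real^'n^'n" where
  "rgd_factor P \<gamma> \<eta> A =
     \<eta> *\<^sub>R (\<integral>B. GM (matrix_inv A) B \<partial>P) + (\<eta> * \<gamma>) *\<^sub>R matrix_inv A
       + (1 - \<eta> * (1 + \<gamma>)) *\<^sub>R mat 1"

primrec rgd ::
    "(real^'n^'n) measure \<Rightarrow> real \<Rightarrow> real \<Rightarrow> real^'n^'n \<Rightarrow> nat \<Rightarrow> real^'n^'n" where
  "rgd P \<gamma> \<eta> A0 0 = A0"
| "rgd P \<gamma> \<eta> A0 (Suc t) =
     (let A = rgd P \<gamma> \<eta> A0 t; S = rgd_factor P \<gamma> \<eta> A in S ** A ** S)"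

end

theory Submission
  imports Defs
begin

text \<open>
Write \<open>T\<^sub>B = GM (\<Sigma>\<inverse>) B\<close> for the optimal transport map from \<open>N(0,\<Sigma>)\<close> to \<open>N(0,B)\<close>, \<open>M\<close> for its
mean over \<open>P\<close>, and \<open>G = (1 + \<gamma>) I - M - \<gamma> \<Sigma>\<inverse>\<close>.  A gradient step is \<open>\<Sigma> \<mapsto> S \<Sigma> S\<close> with
\<open>S = I - \<eta> G\<close>.  Put \<open>k = sqrt \<kappa>\<close> and call \<^emph>\<open>box\<close> the set of covariances with eigenvalues in
\<open>[1/k, k]\<close>; almost all of \<open>P\<close> lives there.  Linear convergence follows from three facts.

\<^item> The box is invariant under gradient steps.  The upper bound is the triangle inequality for
the norm \<open>|\<Sigma>\<^bsup>1/2\<^esup> v|\<close>, in which \<open>T\<^sub>B x\<close>, \<open>\<Sigma>\<inverse> x\<close> and \<open>x\<close> all have length at most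
\<open>sqrt k |x|\<close>.  For the lower bound, expanding a square gives
\<open>S \<Sigma> S \<ge> 2 c S - c\<^sup>2 \<Sigma>\<inverse>\<close> with \<open>c = 1/k\<close>, which reduces the claim to a bound that is
linear in \<open>S\<close>; it holds because \<open>T\<^sub>B \<ge> c \<Sigma>\<inverse>\<close> (\<open>step_in_box\<close>).

\<^item> A gradient step decreases \<open>F\<close> by at least half of \<open>\<eta> tr (G \<Sigma> G)\<close>.  The coupling
\<open>(S X, T\<^sub>B X)\<close> with \<open>X \<sim> N(0,\<Sigma>)\<close> bounds the transport cost by a quadratic
polynomial in \<open>\<eta>\<close>, and the log-determinant is controlled by a second-order expansion (\<open>descent\<close>).

\<^item> The gradient dominates the gap: \<open>F \<Sigma> - F \<Sigma>' \<le> k\<^sup>7/2 tr (G \<Sigma> G)\<close> on the box.  The point is that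
\<open>F\<close>, which need not be convex along Wasserstein geodesics, is strongly convex on the box in the
plain Euclidean sense, with Euclidean gradient \<open>G/2\<close>.  For the transport part the Bregman
divergence is an exact quadratic form in \<open>T'\<^sub>B - T\<^sub>B\<close> (\<open>W2_sq_bregman\<close>), and on the box the
distance of two covariances is at most a multiple of that of their transport maps
(\<open>norm_diff_le_transport_diff\<close>).  Of the entropy only convexity enters, so the modulus does not
degenerate as \<open>\<gamma>\<close> tends to zero.

Gradient domination is applied with \<open>\<Sigma>'\<close> the minimiser, so the minimiser must lie in the box.  The
descent estimate holds for arbitrary positive definite matrices and small steps, hence the
gradient vanishes at the minimiser, and evaluating \<open>M + \<gamma> \<Sigma>\<inverse> = (1 + \<gamma>) I\<close> at extremal
eigenvectors confines the spectrum (\<open>critical_point_in_box\<close>).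
Together the three facts contract the gap by the factor \<open>1 - \<eta>/k\<^sup>7\<close> in each step, which is better than the rate claimed.

Square roots, determinant estimates and the passage from eigenvalues to quadratic forms all rest
on the spectral theorem for real symmetric matrices.
\<close>

section \<open>Matrix algebra\<close>

text \<open>
These rules would turn \<open>A\<^sup>T v\<close> into a row-vector product, hiding products of matrices from
associativity.
\<close>

declare transpose_matrix_vector [simp del] vector_transpose_matrix [simp del]

lemma bounded_bilinear_matrix_mult:
  "bounded_bilinear ((**) :: real^'n^'n \<Rightarrow> real^'n^'n \<Rightarrow> real^'n^'n)"
proof -
  have "bilinear ((**) :: real^'n^'n \<Rightarrow> real^'n^'n \<Rightarrow> real^'n^'n)"
    unfolding bilinear_def
    by (auto intro!: linearI simp: matrix_add_ldistrib matrix_scalar_ac scalar_matrix_assoc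
        matrix_matrix_mult_def vec_eq_iff sum.distrib
        distrib_right distrib_left sum_distrib_left mult_ac)
  then show ?thesis
    by (simp add: bilinear_conv_bounded_bilinear)
qed

lemma bounded_bilinear_matrix_vector_mult:
  "bounded_bilinear ((*v) :: real^'n^'n \<Rightarrow> real^'n \<Rightarrow> real^'n)"
proof -
  have "bilinear ((*v) :: real^'n^'n \<Rightarrow> real^'n \<Rightarrow> real^'n)"
    unfolding bilinear_def
    by (auto intro!: linearI simp: matrix_vector_mult_def vec_eq_iff sum.distrib
        distrib_right distrib_left sum_distrib_left mult_ac)
  then show ?thesis
    by (simp add: bilinear_conv_bounded_bilinear)
qed

interpretation matmul: bounded_bilinear "(**) :: real^'n^'n \<Rightarrow> real^'n^'n \<Rightarrow> real^'n^'n"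
  by (rule bounded_bilinear_matrix_mult)

interpretation matvec: bounded_bilinear "(*v) :: real^'n^'n \<Rightarrow> real^'n \<Rightarrow> real^'n"
  by (rule bounded_bilinear_matrix_vector_mult)

lemma bounded_linear_transpose: "bounded_linear (transpose :: real^'n^'n \<Rightarrow> real^'n^'n)"
  by (rule linear_conv_bounded_linear[THEN iffD1])
    (auto intro!: linearI simp: transpose_def vec_eq_iff)

lemma bounded_linear_trace: "bounded_linear (trace :: real^'n^'n \<Rightarrow> real)"
  by (rule linear_conv_bounded_linear[THEN iffD1])
    (auto intro!: linearI simp: trace_def sum.distrib sum_distrib_left)

lemmas trace_linear = bounded_linear.linear[OF bounded_linear_trace]
lemmas transpose_linear = bounded_linear.linear[OF bounded_linear_transpose]

lemmas mat_expand = matmul.add_left matmul.add_right matmul.diff_left matmul.diff_right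
  matmul.minus_left matmul.minus_right matmul.scaleR_left matmul.scaleR_right
  linear_add[OF trace_linear] linear_diff[OF trace_linear] linear_neg[OF trace_linear]
  linear_cmul[OF trace_linear] matrix_mul_assoc

lemmas transpose_expand = linear_add[OF transpose_linear] linear_diff[OF transpose_linear]
  linear_neg[OF transpose_linear] linear_cmul[OF transpose_linear] matrix_transpose_mul

lemmas vec_expand = matvec.add_left matvec.add_right matvec.diff_left matvec.diff_right
  matvec.minus_left matvec.minus_right matvec.scaleR_left matvec.scaleR_right
  inner_add_left inner_add_right inner_diff_left inner_diff_right

lemma inner_matrix_vector: "(A *v x) \<bullet> y = x \<bullet> (transpose A *v y)" for A :: "real^'n^'n"
  by (metis dot_lmul_matrix inner_commute transpose_matrix_vector)

lemma symmetric_inner: "transpose A = A \<Longrightarrow> (A *v x) \<bullet> y = x \<bullet> (A *v y)" for A :: "real^'n^'n"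
  by (simp add: inner_matrix_vector)

lemma inner_eq_trace: "A \<bullet> B = trace (transpose A ** B)" for A B :: "real^'n^'n"
  unfolding trace_def matrix_matrix_mult_def transpose_def inner_vec_def
  by (simp, rule sum.swap)

lemma trace_transpose: "trace (transpose A) = trace A"
  by (simp add: trace_def transpose_def)

lemma inner_symmetric_eq_trace: "transpose A = A \<Longrightarrow> A \<bullet> B = trace (A ** B)"
  for A B :: "real^'n^'n"
  by (simp add: inner_eq_trace)

lemma trace_transpose_mult_self: "trace (transpose X ** X) = (norm X)\<^sup>2" for X :: "real^'n^'n"
  by (simp add: inner_eq_trace[symmetric] power2_norm_eq_inner)

section \<open>The spectral theorem\<close>

text \<open>
A minimiser of the quadratic form on the unit sphere of the subspace is an eigenvector: otherwise
moving it along the residual \<open>A x - l x\<close> would decrease the Rayleigh quotient to first order.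
\<close>

lemma invariant_subspace_eigenvector:
  fixes A :: "real^'n^'n"
  assumes sym: "transpose A = A" and S: "subspace S" and ne: "S \<noteq> {0}"
    and inv: "\<And>x. x \<in> S \<Longrightarrow> A *v x \<in> S"
  obtains x l where "x \<in> S" "norm x = 1" "A *v x = l *\<^sub>R x"
    "\<And>y. y \<in> S \<Longrightarrow> l * (y \<bullet> y) \<le> y \<bullet> (A *v y)"
proof -
  let ?K = "sphere 0 1 \<inter> S"
  have "compact ?K"
    by (simp add: S closed_subspace compact_Int_closed)
  moreover have "?K \<noteq> {}"
  proof -
    obtain z where "z \<in> S" "z \<noteq> 0" using ne S subspace_0 by blast
    then have "z /\<^sub>R norm z \<in> ?K" using S by (simp add: subspace_scale)
    then show ?thesis by blast
  qed
  moreover have "continuous_on ?K (\<lambda>x. x \<bullet> (A *v x))"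
    by (intro continuous_on_inner continuous_on_id linear_continuous_on[OF matvec.bounded_linear_right])
  ultimately obtain x where x: "x \<in> ?K" and min: "\<And>y. y \<in> ?K \<Longrightarrow> x \<bullet> (A *v x) \<le> y \<bullet> (A *v y)"
    using continuous_attains_inf[of ?K "\<lambda>x. x \<bullet> (A *v x)"] by blast
  define l where "l = x \<bullet> (A *v x)"
  have xx: "x \<bullet> x = 1" using x by (simp add: norm_eq_1)
  have low: "l * (y \<bullet> y) \<le> y \<bullet> (A *v y)" if "y \<in> S" for y
  proof (cases "y = 0")
    case False
    have "y /\<^sub>R norm y \<in> ?K" using that False S by (simp add: subspace_scale)
    from min[OF this] have "l \<le> (y \<bullet> (A *v y)) / (norm y)\<^sup>2"
      by (simp add: l_def matvec.scaleR_right power2_eq_square divide_inverse mult_ac)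
    then show ?thesis using False by (simp add: power2_norm_eq_inner field_simps)
  qed simp
  define z where "z = A *v x - l *\<^sub>R x"
  have zS: "z \<in> S" using x S inv by (auto simp: z_def intro!: subspace_diff subspace_scale)
  define c where "c = z \<bullet> (A *v z) - l * (z \<bullet> z)"
  \<comment> \<open>the form \<open>A - l\<close> is nonnegative and vanishes at \<open>x\<close>, so along \<open>z\<close> only the linear and
    quadratic terms remain\<close>
  have quad: "0 \<le> 2 * t * (z \<bullet> z) + t\<^sup>2 * c" for t
  proof -
    have "l * ((x + t *\<^sub>R z) \<bullet> (x + t *\<^sub>R z)) \<le> (x + t *\<^sub>R z) \<bullet> (A *v (x + t *\<^sub>R z))"
      using x zS S by (intro low) (auto intro!: subspace_add subspace_scale)
    moreover have "x \<bullet> (A *v z) = z \<bullet> (A *v x)"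
      using symmetric_inner[OF sym] by (metis inner_commute)
    moreover have "z \<bullet> (A *v x) = z \<bullet> z + l * (z \<bullet> x)"
      by (simp add: z_def vec_expand)
    ultimately show ?thesis
      using xx by (simp add: vec_expand c_def l_def[symmetric] power2_eq_square algebra_simps
          inner_commute[of x z])
  qed
  have "z \<bullet> z = 0"
  proof (rule ccontr)
    assume "z \<bullet> z \<noteq> 0"
    then have pos: "z \<bullet> z > 0" by simp
    \<comment> \<open>negative and so small that the linear term dominates\<close>
    define t where "t = - (z \<bullet> z) / (\<bar>c\<bar> + 1)"
    have "t < 0" using pos by (simp add: t_def divide_neg_pos)
    have "- t * \<bar>c\<bar> < 2 * (z \<bullet> z)"
    proof -
      have "- t * \<bar>c\<bar> = (z \<bullet> z) * (\<bar>c\<bar> / (\<bar>c\<bar> + 1))" by (simp add: t_def)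
      also have "\<dots> \<le> (z \<bullet> z) * 1" using pos by (intro mult_left_mono) auto
      finally show ?thesis using pos by linarith
    qed
    moreover have "- (t * c) \<le> - t * \<bar>c\<bar>"
      using \<open>t < 0\<close> abs_ge_minus_self[of "t * c"] by (simp add: abs_mult)
    ultimately have "0 < 2 * (z \<bullet> z) + t * c" by linarith
    then have "t * (2 * (z \<bullet> z) + t * c) < 0" using \<open>t < 0\<close> by (simp add: mult_neg_pos)
    then show False using quad[of t] by (simp add: power2_eq_square algebra_simps)
  qed
  then have "A *v x = l *\<^sub>R x" by (simp add: z_def)
  then show thesis using that[of x l] x low by simp
qed

text \<open>
The orthogonal complement of a set of eigenvectors is again invariant, so one more
eigenvector can be split off as long as that complement is nontrivial.
\<close>

lemma orthonormal_eigenvectors_exist: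
  fixes A :: "real^'n^'n"
  assumes sym: "transpose A = A" and "k \<le> CARD('n)"
  shows "\<exists>B. finite B \<and> card B = k \<and> pairwise orthogonal B \<and>
           (\<forall>b\<in>B. norm b = 1 \<and> (\<exists>l. A *v b = l *\<^sub>R b))"
  using assms(2)
proof (induction k)
  case 0
  show ?case by (rule exI[of _ "{}"]) simp
next
  case (Suc k)
  then have "k \<le> CARD('n)" by simp
  from Suc.IH[OF this] obtain B where B: "finite B" "card B = k" "pairwise orthogonal B"
    "\<forall>b\<in>B. norm b = 1 \<and> (\<exists>l. A *v b = l *\<^sub>R b)"
    by (elim exE conjE)
  define S where "S = {x. \<forall>b\<in>B. orthogonal b x}"
  have S: "subspace S"
    unfolding S_def by (rule subspace_orthogonal_to_vectors)
  have "S \<noteq> {0}"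
  proof
    assume "S = {0}"
    have "span B \<noteq> UNIV"
    proof
      assume "span B = UNIV"
      have "dim (UNIV :: (real^'n) set) \<le> card B"
        by (rule dim_le_card) (simp_all add: \<open>span B = UNIV\<close> B(1))
      then show False using B(2) Suc.prems by (simp add: dim_UNIV)
    qed
    then have "span B \<subset> span UNIV" by (simp add: psubset_eq)
    then obtain u where u: "u \<noteq> 0" "\<And>x. x \<in> span B \<Longrightarrow> orthogonal u x"
      by (rule orthogonal_to_subspace_exists_gen) (rule that)
    then have "u \<in> S" by (auto simp: S_def orthogonal_commute span_base)
    then show False using \<open>S = {0}\<close> u by simp
  qed
  moreover have "A *v x \<in> S" if "x \<in> S" for x
    unfolding S_def
  proof (safe)
    fix b assume b: "b \<in> B"
    then obtain l where "A *v b = l *\<^sub>R b" using B by blast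
    then have "b \<bullet> (A *v x) = l * (b \<bullet> x)"
      using symmetric_inner[OF sym, of b x] by simp
    then show "orthogonal b (A *v x)" using that b by (simp add: S_def orthogonal_def)
  qed
  ultimately obtain x l where x: "x \<in> S" "norm x = 1" "A *v x = l *\<^sub>R x"
    by (rule invariant_subspace_eigenvector[OF sym S])
  have "x \<notin> B"
  proof
    assume "x \<in> B"
    then have "x \<bullet> x = 0" using x(1) by (simp add: S_def orthogonal_def)
    then show False using x(2) by simp
  qed
  moreover have "pairwise orthogonal (insert x B)"
    using B(3) x(1) by (simp add: pairwise_insert S_def orthogonal_commute)
  moreover have "\<forall>b\<in>insert x B. norm b = 1 \<and> (\<exists>l. A *v b = l *\<^sub>R b)"
    using B(4) x(2,3) by blast
  ultimately show ?case
    using B(1,2) by (intro exI[of _ "insert x B"]) simp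
qed

definition diag :: "('n \<Rightarrow> real) \<Rightarrow> real^'n^'n" where
  "diag d = (\<chi> i j. if i = j then d i else 0)"

lemma transpose_diag [simp]: "transpose (diag d) = diag d"
  by (auto simp: diag_def transpose_def vec_eq_iff)

lemma diag_mult_diag: "diag d ** diag e = diag (\<lambda>i. d i * e i)"
  unfolding diag_def matrix_matrix_mult_def
  by (simp add: vec_eq_iff mult_delta_left mult_delta_right)

lemma diag_mult_vector: "diag d *v x = (\<chi> i. d i * x $ i)"
  unfolding diag_def matrix_vector_mult_def
  by (simp add: vec_eq_iff mult_delta_left mult_delta_right)

lemma trace_diag: "trace (diag d) = (\<Sum>i\<in>UNIV. d i)"
  by (simp add: trace_def diag_def)

lemma det_diag: "det (diag d) = (\<Prod>i\<in>UNIV. d i)"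
  by (subst det_diagonal) (auto simp: diag_def)

lemma spectral_theorem:
  fixes A :: "real^'n^'n"
  assumes sym: "transpose A = A"
  obtains Q d where "orthogonal_matrix Q" "A = Q ** diag d ** transpose Q"
proof -
  obtain B where B: "finite B" "card B = CARD('n)" "pairwise orthogonal B"
    and e: "\<forall>b\<in>B. norm b = 1 \<and> (\<exists>l. A *v b = l *\<^sub>R b)"
    using orthonormal_eigenvectors_exist[OF sym le_refl] by (elim exE conjE)
  obtain f :: "'n \<Rightarrow> real^'n" where f: "bij_betw f UNIV B"
    using B(1,2) finite_same_card_bij[of "UNIV :: 'n set" B] by auto
  have fB: "f i \<in> B" for i using f by (auto simp: bij_betw_def)
  have "\<forall>i. \<exists>l. A *v f i = l *\<^sub>R f i" using e fB by blast
  from choice[OF this] obtain d where d: "\<And>i. A *v f i = d i *\<^sub>R f i" by blast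
  define Q where "Q = transpose (\<chi> i. f i)"
  have col: "column i Q = f i" for i by (simp add: Q_def row_def vec_eq_iff)
  have Q: "orthogonal_matrix Q"
    unfolding orthogonal_matrix_orthonormal_columns col
  proof (intro conjI allI impI)
    show "norm (f i) = 1" for i using e fB by blast
    show "orthogonal (f i) (f j)" if "i \<noteq> j" for i j
      using B(3) fB f that by (simp add: pairwise_def bij_betw_def inj_eq)
  qed
  have "A ** Q = Q ** diag d"
  proof -
    have "column j (A ** Q) = column j (Q ** diag d)" for j
    proof -
      have "column j (A ** Q) = A *v column j Q"
        by (simp add: column_def matrix_matrix_mult_def matrix_vector_mult_def vec_eq_iff)
      also have "\<dots> = d j *\<^sub>R column j Q" by (simp add: col d)
      also have "\<dots> = column j (Q ** diag d)"
        by (simp add: column_def matrix_matrix_mult_def diag_def vec_eq_iff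
            mult_delta_right mult.commute)
      finally show ?thesis .
    qed
    then show ?thesis by (simp add: column_def vec_eq_iff)
  qed
  then have "A ** (Q ** transpose Q) = Q ** diag d ** transpose Q"
    by (simp add: matrix_mul_assoc)
  then have "A = Q ** diag d ** transpose Q"
    using Q by (simp add: orthogonal_matrix_def)
  then show thesis using that Q by blast
qed

lemma min_eigenvector:
  fixes A :: "real^'n^'n"
  assumes "transpose A = A"
  obtains x l where "norm x = 1" "A *v x = l *\<^sub>R x" "\<And>y. l * (y \<bullet> y) \<le> y \<bullet> (A *v y)"
proof (rule invariant_subspace_eigenvector[OF assms subspace_UNIV])
  show "(UNIV :: (real^'n) set) \<noteq> {0}" by (rule UNIV_not_singleton)
qed (simp, rule that, simp_all)

lemma max_eigenvector:
  fixes A :: "real^'n^'n"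
  assumes "transpose A = A"
  obtains x l where "norm x = 1" "A *v x = l *\<^sub>R x" "\<And>y. y \<bullet> (A *v y) \<le> l * (y \<bullet> y)"
proof -
  have "transpose (- A) = - A" by (simp add: transpose_expand assms)
  then obtain x l where "norm x = 1" "(- A) *v x = l *\<^sub>R x"
    and low: "\<And>y. l * (y \<bullet> y) \<le> y \<bullet> ((- A) *v y)"
    by (rule min_eigenvector) (rule that)
  then have "A *v x = (- l) *\<^sub>R x"
    by (simp add: matvec.minus_left eq_neg_iff_add_eq_0 neg_eq_iff_add_eq_0)
  moreover have "y \<bullet> (A *v y) \<le> (- l) * (y \<bullet> y)" for y
    using low[of y] by (simp add: matvec.minus_left)
  ultimately show thesis using that[of x "- l"] \<open>norm x = 1\<close> by blast
qed

section \<open>Positive definite matrices\<close>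

lemma trace_eq_sum_axis: "trace M = (\<Sum>j\<in>UNIV. axis j 1 \<bullet> (M *v axis j 1))" for M :: "real^'n^'n"
  by (simp add: trace_def inner_axis' matrix_vector_mul_component inner_axis)

lemma norm_sq_eq_sum_axis: "(norm X)\<^sup>2 = (\<Sum>j\<in>UNIV. (X *v axis j 1) \<bullet> (X *v axis j 1))"
  for X :: "real^'n^'n"
  unfolding trace_transpose_mult_self[symmetric] trace_eq_sum_axis
  by (simp add: inner_matrix_vector matrix_vector_mul_assoc)

text \<open>
Column by column, \<open>tr (X\<^sup>T E X)\<close> sums the form of \<open>E\<close> over the columns of \<open>X\<close>, and \<open>norm X\<close> is the
Frobenius norm.  With \<open>c = 0\<close> this says that congruence preserves positivity of the trace.
\<close>

lemma trace_congruence_ge: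
  fixes E X :: "real^'n^'n"
  assumes "\<And>x. c * (x \<bullet> x) \<le> x \<bullet> (E *v x)"
  shows "c * (norm X)\<^sup>2 \<le> trace (transpose X ** E ** X)"
proof -
  have "c * (norm X)\<^sup>2 = (\<Sum>j\<in>UNIV. c * ((X *v axis j 1) \<bullet> (X *v axis j 1)))"
    by (simp add: norm_sq_eq_sum_axis sum_distrib_left)
  also have "\<dots> \<le> (\<Sum>j\<in>UNIV. (X *v axis j 1) \<bullet> (E *v (X *v axis j 1)))"
    by (intro sum_mono assms)
  also have "\<dots> = trace (transpose X ** E ** X)"
    unfolding trace_eq_sum_axis
    by (simp add: inner_matrix_vector matrix_vector_mul_assoc matrix_mul_assoc)
  finally show ?thesis .
qed

lemma norm_transpose: "norm (transpose X) = norm X" for X :: "real^'n^'n"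
proof -
  have "(norm (transpose X))\<^sup>2 = (norm X)\<^sup>2"
    using trace_transpose_mult_self[of X] trace_transpose_mult_self[of "transpose X"]
      trace_mul_sym[of X "transpose X"] by simp
  then show ?thesis by (simp add: power2_eq_iff_nonneg)
qed

lemma norm_matmul_le_left:
  fixes X Y :: "real^'n^'n"
  assumes "\<And>v. norm (X *v v) \<le> c * norm v" "0 \<le> c"
  shows "norm (X ** Y) \<le> c * norm Y"
proof (rule power2_le_imp_le)
  have "(norm (X ** Y))\<^sup>2 = (\<Sum>j\<in>UNIV. (norm (X *v (Y *v axis j 1)))\<^sup>2)"
    by (simp add: norm_sq_eq_sum_axis power2_norm_eq_inner matrix_vector_mul_assoc)
  also have "\<dots> \<le> (\<Sum>j\<in>UNIV. (c * norm (Y *v axis j 1))\<^sup>2)"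
    by (intro sum_mono power_mono assms) simp
  also have "\<dots> = (c * norm Y)\<^sup>2"
    by (simp add: norm_sq_eq_sum_axis power2_norm_eq_inner power_mult_distrib sum_distrib_left)
  finally show "(norm (X ** Y))\<^sup>2 \<le> (c * norm Y)\<^sup>2" .
qed (use assms(2) in simp)

lemma norm_matmul_le_right:
  fixes X Y :: "real^'n^'n"
  assumes "\<And>v. norm (transpose X *v v) \<le> c * norm v" "0 \<le> c"
  shows "norm (Y ** X) \<le> c * norm Y"
  using norm_matmul_le_left[OF assms, where Y = "transpose Y"]
  by (metis matrix_transpose_mul norm_transpose)

lemma SPD_sym: "A \<in> SPD \<Longrightarrow> transpose A = A"
  by (simp add: SPD_def)

lemma SPD_pos: "A \<in> SPD \<Longrightarrow> x \<noteq> 0 \<Longrightarrow> 0 < x \<bullet> (A *v x)"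
  by (simp add: SPD_def)

lemma SPD_nonneg: "A \<in> SPD \<Longrightarrow> 0 \<le> x \<bullet> (A *v x)"
  using SPD_pos[of A x] by (cases "x = 0") auto

lemma SPD_I:
  assumes "transpose A = A" "0 < c" "\<And>x. c * (x \<bullet> x) \<le> x \<bullet> (A *v x)"
  shows "A \<in> SPD"
  unfolding SPD_def using assms
  by (auto intro: less_le_trans[OF mult_pos_pos assms(3)])

lemma SPD_lower_bound:
  assumes "A \<in> SPD"
  obtains c where "0 < c" "\<And>x. c * (x \<bullet> x) \<le> x \<bullet> (A *v x)"
proof -
  obtain e l where e: "norm e = 1" "A *v e = l *\<^sub>R e"
    and l: "\<And>y. l * (y \<bullet> y) \<le> y \<bullet> (A *v y)"
    by (rule min_eigenvector[OF SPD_sym[OF assms]]) (rule that)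
  have "e \<noteq> 0" using e by auto
  then have "0 < e \<bullet> (A *v e)" by (rule SPD_pos[OF assms])
  then have "0 < l" using e by (simp add: norm_eq_1)
  then show thesis using l by (rule that)
qed

lemma SPD_kernel: "A \<in> SPD \<Longrightarrow> A *v x = 0 \<Longrightarrow> x = 0"
  using SPD_pos[of A x] by (cases "x = 0") auto

lemma SPD_inv:
  assumes "A \<in> SPD"
  shows "A ** matrix_inv A = mat 1" "matrix_inv A ** A = mat 1"
proof -
  have "\<exists>B. B ** A = mat 1"
    unfolding matrix_left_invertible_ker using SPD_kernel[OF assms] by blast
  then have "invertible A" by (simp add: invertible_left_inverse)
  then show "A ** matrix_inv A = mat 1" "matrix_inv A ** A = mat 1"
    unfolding invertible_def matrix_inv_def by (metis (mono_tags, lifting) someI_ex)+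
qed

lemma SPD_inv_vector:
  assumes "A \<in> SPD"
  shows "A *v (matrix_inv A *v x) = x" "matrix_inv A *v (A *v x) = x"
  by (simp_all add: matrix_vector_mul_assoc SPD_inv[OF assms])

lemma SPD_congruence:
  assumes "A \<in> SPD" "X \<in> SPD"
  shows "X ** A ** X \<in> SPD"
proof -
  have "transpose (X ** A ** X) = X ** A ** X"
    using assms[THEN SPD_sym] by (simp add: matrix_transpose_mul matrix_mul_assoc)
  moreover have "0 < x \<bullet> ((X ** A ** X) *v x)" if "x \<noteq> 0" for x
  proof -
    have "X *v x \<noteq> 0" using SPD_kernel[OF assms(2)] that by blast
    then have "0 < (X *v x) \<bullet> (A *v (X *v x))" by (rule SPD_pos[OF assms(1)])
    also have "\<dots> = x \<bullet> ((X ** A ** X) *v x)"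
      by (simp add: symmetric_inner[OF SPD_sym[OF assms(2)]] matrix_vector_mul_assoc matrix_mul_assoc)
    finally show ?thesis .
  qed
  ultimately show ?thesis by (simp add: SPD_def)
qed

lemma SPD_matrix_inv:
  assumes "A \<in> SPD"
  shows "matrix_inv A \<in> SPD"
proof -
  let ?B = "matrix_inv A"
  have "transpose ?B ** A = mat 1"
    using SPD_inv(1)[OF assms] SPD_sym[OF assms] by (metis matrix_transpose_mul transpose_mat)
  then have sym: "transpose ?B = ?B"
    by (metis SPD_inv(1)[OF assms] matrix_mul_assoc matrix_mul_lid matrix_mul_rid)
  have "0 < x \<bullet> (?B *v x)" if "x \<noteq> 0" for x
  proof -
    have "?B *v x \<noteq> 0" using SPD_inv_vector(1)[OF assms, of x] that by auto
    from SPD_pos[OF assms this] show ?thesis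
      by (simp add: SPD_inv_vector[OF assms] inner_commute)
  qed
  with sym show ?thesis by (simp add: SPD_def)
qed

lemma spectral_lower:
  assumes Q: "orthogonal_matrix Q" and A: "A = Q ** diag d ** transpose Q"
    and low: "\<And>x. c * (x \<bullet> x) \<le> x \<bullet> (A *v x)"
  shows "c \<le> d i"
proof -
  have QQ: "transpose Q ** Q = mat 1" using Q by (simp add: orthogonal_matrix)
  let ?x = "Q *v axis i 1"
  have "?x \<bullet> ?x = 1"
    by (simp add: inner_matrix_vector matrix_vector_mul_assoc QQ inner_axis)
  moreover have "?x \<bullet> (A *v ?x) = d i"
  proof -
    have "?x \<bullet> (A *v ?x) = axis i 1 \<bullet> ((transpose Q ** Q ** diag d ** (transpose Q ** Q)) *v axis i 1)"
      unfolding A by (simp add: inner_matrix_vector matrix_vector_mul_assoc matrix_mul_assoc)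
    also have "\<dots> = d i"
      by (simp add: QQ diag_mult_vector inner_axis')
    finally show ?thesis .
  qed
  ultimately show ?thesis using low[of ?x] by simp
qed

lemma spectral_trace:
  assumes "orthogonal_matrix Q"
  shows "trace (Q ** diag d ** transpose Q) = (\<Sum>i\<in>UNIV. d i)"
  using assms
  by (metis matrix_mul_assoc matrix_mul_rid orthogonal_matrix trace_diag trace_mul_sym)

lemma spectral_det:
  assumes "orthogonal_matrix Q"
  shows "det (Q ** diag d ** transpose Q) = (\<Prod>i\<in>UNIV. d i)"
proof -
  have "det Q * det (transpose Q) = 1"
    using assms by (metis det_I det_mul orthogonal_matrix_def)
  then show ?thesis by (simp add: det_mul det_diag)
qed

lemma SPD_spectral:
  assumes "A \<in> SPD"
  obtains Q d where "orthogonal_matrix Q" "A = Q ** diag d ** transpose Q" "\<And>i. 0 < d i"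
proof -
  obtain Q d where Q: "orthogonal_matrix Q" "A = Q ** diag d ** transpose Q"
    by (rule spectral_theorem[OF SPD_sym[OF assms]]) (rule that)
  obtain c where "0 < c" "\<And>x. c * (x \<bullet> x) \<le> x \<bullet> (A *v x)"
    by (rule SPD_lower_bound[OF assms]) (rule that)
  then have "0 < d i" for i using spectral_lower[OF Q, of c i] by simp
  with Q show thesis by (rule that)
qed

lemma det_SPD_pos: "A \<in> SPD \<Longrightarrow> 0 < det A"
  by (erule SPD_spectral) (simp add: spectral_det prod_pos)

lemma ln_det_le_trace:
  fixes A :: "real^'n^'n"
  assumes "A \<in> SPD"
  shows "ln (det A) \<le> trace A - real CARD('n)"
proof -
  obtain Q d where Q: "orthogonal_matrix Q" "A = Q ** diag d ** transpose Q" and d: "\<And>i. 0 < d i"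
    by (rule SPD_spectral[OF assms]) (rule that)
  have nz: "d i \<noteq> 0" for i using d[of i] by simp
  have "ln (det A) = (\<Sum>i\<in>UNIV. ln (d i))"
    by (simp add: Q(2) spectral_det[OF Q(1)] ln_prod nz)
  also have "\<dots> \<le> (\<Sum>i\<in>UNIV. d i - 1)"
    by (intro sum_mono ln_le_minus_one d)
  also have "\<dots> = trace A - real CARD('n)"
    by (simp add: Q(2) spectral_trace[OF Q(1)] sum_subtractf)
  finally show ?thesis .
qed

lemma neg_ln_le_quadratic:
  fixes x :: real
  assumes "1/2 \<le> x"
  shows "- ln x \<le> (1 - x) + 2 * (1 - x)\<^sup>2"
proof (cases "x \<le> 1")
  case True
  then show ?thesis
    using ln_one_minus_pos_lower_bound[of "1 - x"] assms by simp
next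
  case False
  show ?thesis
  proof (cases "x \<le> 2")
    case True
    then have "(x - 1) - (x - 1)\<^sup>2 \<le> ln x"
      using ln_one_plus_pos_lower_bound[of "x - 1"] False by simp
    moreover have "(x - 1)\<^sup>2 = (1 - x)\<^sup>2" by (rule power2_commute)
    ultimately show ?thesis using zero_le_power2[of "1 - x"] by linarith
  next
    case False
    then have "x - 1 \<le> (1 - x)\<^sup>2"
      using mult_left_mono[of 1 "x - 1" "x - 1"] by (simp add: power2_eq_square algebra_simps)
    moreover have "0 \<le> ln x" using False by simp
    ultimately show ?thesis using False by linarith
  qed
qed

lemma neg_ln_det_le_quadratic:
  fixes S :: "real^'n^'n"
  assumes sym: "transpose S = S" and low: "\<And>x. 1/2 * (x \<bullet> x) \<le> x \<bullet> (S *v x)"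
  shows "- ln (det S) \<le> trace (mat 1 - S) + 2 * (norm (mat 1 - S))\<^sup>2"
proof -
  obtain Q d where Q: "orthogonal_matrix Q" "S = Q ** diag d ** transpose Q"
    by (rule spectral_theorem[OF sym]) (rule that)
  have d: "1/2 \<le> d i" for i
    by (rule spectral_lower[OF Q low])
  have QQ: "transpose Q ** Q = mat 1" "Q ** transpose Q = mat 1"
    using Q(1) by (simp_all add: orthogonal_matrix_def)
  have "(mat 1 :: real^'n^'n) = diag (\<lambda>i. 1)" by (simp add: mat_def diag_def)
  then have dm: "mat 1 - diag d = diag (\<lambda>i. 1 - d i)"
    by (simp add: diag_def vec_eq_iff)
  have "mat 1 - S = Q ** (mat 1 - diag d) ** transpose Q"
    by (simp add: mat_expand Q(2) QQ)
  then have D: "mat 1 - S = Q ** diag (\<lambda>i. 1 - d i) ** transpose Q"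
    by (simp only: dm)
  have "(norm (mat 1 - S))\<^sup>2
      = trace (Q ** diag (\<lambda>i. 1 - d i) ** (transpose Q ** Q) ** diag (\<lambda>i. 1 - d i) ** transpose Q)"
    unfolding trace_transpose_mult_self[symmetric] D
    by (simp add: matrix_transpose_mul matrix_mul_assoc)
  also have "\<dots> = trace (Q ** diag (\<lambda>i. (1 - d i)\<^sup>2) ** transpose Q)"
    by (simp add: QQ matrix_mul_assoc[symmetric] power2_eq_square)
      (simp add: matrix_mul_assoc diag_mult_diag)
  finally have n: "(norm (mat 1 - S))\<^sup>2 = (\<Sum>i\<in>UNIV. (1 - d i)\<^sup>2)"
    by (simp add: spectral_trace[OF Q(1)])
  have nz: "d i \<noteq> 0" for i using d[of i] by auto
  have "- ln (det S) = (\<Sum>i\<in>UNIV. - ln (d i))"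
    by (simp add: Q(2) spectral_det[OF Q(1)] ln_prod nz sum_negf)
  also have "\<dots> \<le> (\<Sum>i\<in>UNIV. (1 - d i) + 2 * (1 - d i)\<^sup>2)"
    by (intro sum_mono neg_ln_le_quadratic d)
  also have "\<dots> = trace (mat 1 - S) + 2 * (norm (mat 1 - S))\<^sup>2"
    unfolding n by (simp add: D spectral_trace[OF Q(1)] sum.distrib sum_distrib_left)
  finally show ?thesis .
qed

section \<open>The principal square root\<close>

text \<open>
With \<open>D = C - B\<close>, the symmetric part of \<open>D (C + B)\<close> is \<open>C\<^sup>2 - B\<^sup>2\<close>, so pairing the latter with
\<open>D\<close> yields \<open>tr (D (C + B) D)\<close>.  This gives both uniqueness and continuity of the square root,
the latter being needed for measurability of the transport maps.
\<close>

lemma sqrt_lipschitz: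
  fixes B C :: "real^'n^'n"
  assumes B: "psd B" and C: "transpose C = C" and low: "\<And>x. c * (x \<bullet> x) \<le> x \<bullet> (C *v x)"
  shows "c * norm (C - B) \<le> norm (C ** C - B ** B)"
proof (cases "C = B")
  case False
  have symB: "transpose B = B" using B by (simp add: psd_def)
  define D where "D = C - B"
  have symD: "transpose D = D" by (simp add: D_def transpose_expand C symB)
  have "c * (norm D)\<^sup>2 \<le> trace (transpose D ** (C + B) ** D)"
  proof (rule trace_congruence_ge)
    show "c * (x \<bullet> x) \<le> x \<bullet> ((C + B) *v x)" for x
      using low[of x] B by (simp add: psd_def vec_expand add_increasing2)
  qed
  also have "\<dots> = D \<bullet> (C ** C - B ** B)"
  proof -
    have "trace (D ** D ** C) = trace (D ** C ** D)" "trace (D ** D ** B) = trace (D ** B ** D)"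
      by (metis matrix_mul_assoc trace_mul_sym)+
    moreover have "trace (D ** C ** B) = trace (D ** B ** C)"
      by (metis trace_transpose matrix_transpose_mul matrix_mul_assoc trace_mul_sym symD C symB)
    ultimately show ?thesis
      unfolding inner_symmetric_eq_trace[OF symD] symD
      by (simp add: mat_expand D_def)
  qed
  also have "\<dots> \<le> norm D * norm (C ** C - B ** B)"
    by (rule norm_cauchy_schwarz)
  finally have "norm D * (c * norm D) \<le> norm D * norm (C ** C - B ** B)"
    by (simp add: power2_eq_square mult_ac)
  then show ?thesis using False by (simp add: D_def)
qed simp

lemma SPD_imp_psd: "A \<in> SPD \<Longrightarrow> psd A"
  by (simp add: psd_def SPD_sym SPD_nonneg)

lemma SPD_sqrt_exists:
  assumes "A \<in> SPD"
  obtains C where "C \<in> SPD" "C ** C = A"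
proof -
  obtain Q d where Q: "orthogonal_matrix Q" "A = Q ** diag d ** transpose Q" and d: "\<And>i. 0 < d i"
    by (rule SPD_spectral[OF assms]) (rule that)
  have QQ: "transpose Q ** Q = mat 1" "Q ** transpose Q = mat 1"
    using Q(1) by (simp_all add: orthogonal_matrix_def)
  define C where "C = Q ** diag (\<lambda>i. sqrt (d i)) ** transpose Q"
  have "C ** C = Q ** diag (\<lambda>i. sqrt (d i)) ** (transpose Q ** Q) ** diag (\<lambda>i. sqrt (d i)) ** transpose Q"
    by (simp add: C_def matrix_mul_assoc)
  also have "\<dots> = Q ** (diag (\<lambda>i. sqrt (d i)) ** diag (\<lambda>i. sqrt (d i))) ** transpose Q"
    by (simp add: QQ matrix_mul_assoc)
  also have "\<dots> = A"
    using d by (simp add: diag_mult_diag Q(2) less_imp_le)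
  finally have sq: "C ** C = A" .
  have sym: "transpose C = C"
    by (simp add: C_def matrix_transpose_mul matrix_mul_assoc)
  have "0 < x \<bullet> (C *v x)" if "x \<noteq> 0" for x
  proof -
    let ?y = "transpose Q *v x"
    have "x = Q *v ?y" by (simp add: matrix_vector_mul_assoc QQ)
    then have "?y \<noteq> 0" using that by auto
    then obtain i where i: "?y $ i \<noteq> 0" by (auto simp: vec_eq_iff)
    have "x \<bullet> (C *v x) = ?y \<bullet> (diag (\<lambda>i. sqrt (d i)) *v ?y)"
      by (simp add: C_def inner_matrix_vector matrix_vector_mul_assoc matrix_mul_assoc)
    also have "\<dots> = (\<Sum>i\<in>UNIV. sqrt (d i) * (?y $ i)\<^sup>2)"
      by (simp add: diag_mult_vector inner_vec_def power2_eq_square mult_ac)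
    also have "0 < \<dots>"
      using d i by (intro sum_pos2[of _ i]) (auto simp: less_imp_le)
    finally show ?thesis .
  qed
  then have "C \<in> SPD" using sym by (simp add: SPD_def)
  then show thesis using sq by (rule that)
qed

lemma msqrt_eq:
  assumes "C \<in> SPD" "C ** C = A"
  shows "msqrt A = C"
  unfolding msqrt_def
proof (rule the_equality)
  fix B assume B: "psd B \<and> B ** B = A"
  obtain c where "0 < c" "\<And>x. c * (x \<bullet> x) \<le> x \<bullet> (C *v x)"
    by (rule SPD_lower_bound[OF assms(1)]) (rule that)
  from this sqrt_lipschitz[of B C c] B have "c * norm (C - B) \<le> 0"
    by (simp add: assms SPD_sym)
  with \<open>0 < c\<close> show "B = C" by (simp add: mult_le_0_iff)
qed (use assms SPD_imp_psd in blast)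

lemma msqrt_SPD: "A \<in> SPD \<Longrightarrow> msqrt A \<in> SPD"
  by (metis SPD_sqrt_exists msqrt_eq)

lemma msqrt_square: "A \<in> SPD \<Longrightarrow> msqrt A ** msqrt A = A"
  by (metis SPD_sqrt_exists msqrt_eq)

lemma continuous_on_msqrt: "continuous_on SPD (msqrt :: real^'n^'n \<Rightarrow> _)"
  unfolding continuous_on_def
proof
  fix A :: "real^'n^'n" assume A: "A \<in> SPD"
  obtain c where c: "0 < c" "\<And>x. c * (x \<bullet> x) \<le> x \<bullet> (msqrt A *v x)"
    by (rule SPD_lower_bound[OF msqrt_SPD[OF A]]) (rule that)
  have "norm (msqrt B - msqrt A) \<le> norm (B - A) / c" if "B \<in> SPD" for B
    using sqrt_lipschitz[OF SPD_imp_psd[OF msqrt_SPD[OF that]] SPD_sym[OF msqrt_SPD[OF A]] c(2)] c(1)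
    by (simp add: msqrt_square A that pos_le_divide_eq mult.commute norm_minus_commute)
  then have "\<forall>\<^sub>F B in at A within SPD. norm (msqrt B - msqrt A) \<le> norm (B - A) / c"
    by (simp add: eventually_at_filter)
  moreover have "((\<lambda>B. norm (B - A) / c) \<longlongrightarrow> 0) (at A within SPD)"
    using c(1) by (auto intro!: tendsto_eq_intros)
  ultimately have "((\<lambda>B. msqrt B - msqrt A) \<longlongrightarrow> 0) (at A within SPD)"
    by (rule Lim_null_comparison)
  then show "(msqrt \<longlongrightarrow> msqrt A) (at A within SPD)"
    by (simp add: LIM_zero_iff)
qed

text \<open>
A fragment of operator monotonicity: a scalar lower bound passes to the square root.
\<close>

lemma square_root_lower:
  fixes C :: "real^'n^'n"
  assumes C: "C \<in> SPD" and m: "0 \<le> m" and low: "\<And>x. m\<^sup>2 * (x \<bullet> x) \<le> x \<bullet> ((C ** C) *v x)"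
  shows "m * (x \<bullet> x) \<le> x \<bullet> (C *v x)"
proof -
  obtain e l where e: "norm e = 1" "C *v e = l *\<^sub>R e"
    and l: "\<And>y. l * (y \<bullet> y) \<le> y \<bullet> (C *v y)"
    by (rule min_eigenvector[OF SPD_sym[OF C]]) (rule that)
  have "0 \<le> l" using SPD_nonneg[OF C, of e] e by (simp add: norm_eq_1)
  moreover have "m\<^sup>2 \<le> l\<^sup>2"
    using low[of e] e
    by (simp add: matrix_vector_mul_assoc[symmetric] matvec.scaleR_right norm_eq_1 power2_eq_square)
  ultimately have "m \<le> l" using m by (simp add: abs_le_square_iff[symmetric])
  then show ?thesis using l[of x] by (smt (verit) inner_ge_zero mult_right_mono)
qed

section \<open>Optimal transport maps between Gaussians\<close>

text \<open>
The symmetric matrix \<open>T\<close> with \<open>T A T = B\<close>: the linear map that pushes \<open>N(0,A)\<close> optimally to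
\<open>N(0,B)\<close>.
\<close>

abbreviation transport :: "real^'n^'n \<Rightarrow> real^'n^'n \<Rightarrow> real^'n^'n" where
  "transport A B \<equiv> GM (matrix_inv A) B"

lemma transport_decomposition:
  fixes A B :: "real^'n^'n"
  assumes A: "A \<in> SPD" and B: "B \<in> SPD"
  obtains R R' C where "R \<in> SPD" "R' \<in> SPD" "C \<in> SPD" "R ** R' = mat 1" "R' ** R = mat 1"
    "R' ** R' = A" "R ** R = matrix_inv A" "C ** C = R' ** B ** R'"
    "transport A B = R ** C ** R" "W2_sq A B = trace A + trace B - 2 * trace C"
proof -
  define R where "R = msqrt (matrix_inv A)"
  define R' where "R' = matrix_inv R"
  define C where "C = msqrt (R' ** B ** R')"
  have iA: "matrix_inv A \<in> SPD" by (rule SPD_matrix_inv[OF A])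
  have R: "R \<in> SPD" "R ** R = matrix_inv A"
    unfolding R_def by (rule msqrt_SPD[OF iA], rule msqrt_square[OF iA])
  have R': "R' \<in> SPD" "R ** R' = mat 1" "R' ** R = mat 1"
    unfolding R'_def by (rule SPD_matrix_inv[OF R(1)], (rule SPD_inv[OF R(1)])+)
  have "R ** R ** (R' ** R') = R ** (R ** R') ** R'"
    by (simp only: matrix_mul_assoc)
  also have "\<dots> = mat 1" by (simp add: R'(2))
  finally have "matrix_inv A ** (R' ** R') = mat 1" by (simp only: R(2))
  then have "A ** (matrix_inv A ** (R' ** R')) = A" by simp
  then have RA: "R' ** R' = A"
    by (simp add: matrix_mul_assoc[of A] SPD_inv[OF A])
  have RBR: "R' ** B ** R' \<in> SPD" by (rule SPD_congruence[OF B R'(1)])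
  have C: "C \<in> SPD" "C ** C = R' ** B ** R'"
    unfolding C_def by (rule msqrt_SPD[OF RBR], rule msqrt_square[OF RBR])
  have "transport A B = R ** C ** R"
    by (simp add: GM_def Let_def R_def C_def R'_def)
  moreover have "W2_sq A B = trace A + trace B - 2 * trace C"
    unfolding W2_sq_def msqrt_eq[OF R'(1) RA] C_def by (simp add: mat_expand)
  ultimately show thesis
    by (rule that[OF R(1) R'(1) C(1) R'(2,3) RA R(2) C(2)])
qed

lemma transport_SPD:
  assumes "A \<in> SPD" "B \<in> SPD"
  shows "transport A B \<in> SPD"
  by (rule transport_decomposition[OF assms]) (simp add: SPD_congruence)

lemma transport_push:
  assumes "A \<in> SPD" "B \<in> SPD"
  shows "transport A B ** A ** transport A B = B"
proof -
  obtain R R' C where R: "R ** R' = mat 1" "R' ** R = mat 1" "R' ** R' = A"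
    "C ** C = R' ** B ** R'" "transport A B = R ** C ** R"
    by (rule transport_decomposition[OF assms]) (rule that)
  have "transport A B ** A ** transport A B = (R ** C ** R) ** (R' ** R') ** (R ** C ** R)"
    by (simp only: R(3,5))
  also have "\<dots> = R ** C ** (R ** R') ** (R' ** R) ** C ** R"
    by (simp only: matrix_mul_assoc)
  also have "\<dots> = R ** (C ** C) ** R" by (simp add: R(1,2) matrix_mul_assoc)
  also have "\<dots> = (R ** R') ** B ** (R' ** R)" by (simp add: R(4) matrix_mul_assoc)
  finally show ?thesis by (simp add: R(1,2))
qed

lemma W2_sq_transport:
  assumes "A \<in> SPD" "B \<in> SPD"
  shows "W2_sq A B = trace A + trace B - 2 * trace (A ** transport A B)"
proof -
  obtain R R' C where R: "R ** R' = mat 1" "R' ** R = mat 1" "R' ** R' = A"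
    "transport A B = R ** C ** R" "W2_sq A B = trace A + trace B - 2 * trace C"
    by (rule transport_decomposition[OF assms]) (rule that)
  have "trace (A ** transport A B) = trace ((R' ** R') ** (R ** C ** R))"
    by (simp only: R(3,4))
  also have "\<dots> = trace (R' ** ((R' ** R) ** C ** R))"
    by (simp only: matrix_mul_assoc)
  also have "\<dots> = trace (R' ** (C ** R))" by (simp add: R(2))
  also have "\<dots> = trace (C ** R ** R')" by (rule trace_mul_sym)
  also have "\<dots> = trace (C ** (R ** R'))" by (simp only: matrix_mul_assoc)
  finally show ?thesis by (simp add: R(1,5))
qed

text \<open>
The transport map is an isometry from the norm given by \<open>B\<close> to the norm given by \<open>A\<close>.
\<close>

lemma transport_energy:
  assumes "A \<in> SPD" "B \<in> SPD"
  shows "(transport A B *v x) \<bullet> (A *v (transport A B *v x)) = x \<bullet> (B *v x)"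
proof -
  have "(transport A B *v x) \<bullet> (A *v (transport A B *v x))
      = x \<bullet> ((transport A B ** A ** transport A B) *v x)"
    by (simp add: symmetric_inner[OF SPD_sym[OF transport_SPD[OF assms]]]
        matrix_vector_mul_assoc matrix_mul_assoc)
  then show ?thesis by (simp add: transport_push[OF assms])
qed

text \<open>
Conjugating with \<open>A\<^bsup>1/2\<^esup>\<close> turns \<open>T\<close> into the square root of \<open>A\<^bsup>1/2\<^esup> B A\<^bsup>1/2\<^esup> \<ge> q A \<ge> p q I\<close>.
\<close>

lemma transport_lower_bound:
  fixes A B :: "real^'n^'n"
  assumes AB: "A \<in> SPD" "B \<in> SPD" and pq: "0 \<le> p" "0 \<le> q"
    and A: "\<And>x. p * (x \<bullet> x) \<le> x \<bullet> (A *v x)" and B: "\<And>x. q * (x \<bullet> x) \<le> x \<bullet> (B *v x)"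
  shows "sqrt (p * q) * (x \<bullet> (matrix_inv A *v x)) \<le> x \<bullet> (transport A B *v x)"
proof -
  obtain R R' C where R: "R \<in> SPD" "R' \<in> SPD" "C \<in> SPD" "R' ** R' = A" "R ** R = matrix_inv A"
    "C ** C = R' ** B ** R'" "transport A B = R ** C ** R"
    by (rule transport_decomposition[OF AB]) (rule that)
  have sym: "transpose R = R" "transpose R' = R'" using R(1,2)[THEN SPD_sym] by simp_all
  have "sqrt (p * q) * (y \<bullet> y) \<le> y \<bullet> (C *v y)" for y
  proof (rule square_root_lower[OF R(3)])
    show "(sqrt (p * q))\<^sup>2 * (y \<bullet> y) \<le> y \<bullet> ((C ** C) *v y)" for y
    proof -
      have "p * q * (y \<bullet> y) \<le> q * (y \<bullet> (A *v y))"
        using mult_left_mono[OF A[of y] pq(2)] by (simp add: mult_ac)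
      also have "\<dots> = q * ((R' *v y) \<bullet> (R' *v y))"
        by (simp add: R(4)[symmetric] symmetric_inner[OF sym(2)] matrix_vector_mul_assoc)
      also have "\<dots> \<le> (R' *v y) \<bullet> (B *v (R' *v y))" by (rule B)
      also have "\<dots> = y \<bullet> ((C ** C) *v y)"
        by (simp add: R(6) symmetric_inner[OF sym(2)] matrix_vector_mul_assoc matrix_mul_assoc)
      finally show ?thesis using pq by simp
    qed
  qed (use pq in simp)
  from this[of "R *v x"] show ?thesis
    by (simp only: R(7)) (simp add: R(5)[symmetric] symmetric_inner[OF sym(1)]
        matrix_vector_mul_assoc matrix_mul_assoc)
qed

text \<open>
The right-hand side is the cost of the coupling \<open>(S X, T X)\<close> with \<open>X \<sim> N(0,A)\<close>.  Optimality of the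
left-hand side is a completed square: if \<open>R\<close> is the transport map from \<open>S A S\<close> to \<open>B\<close>, then the
form \<open>R\<close> evaluated at \<open>(S - R\<inverse> T) A\<^bsup>1/2\<^esup>\<close> has nonnegative trace, and both of its diagonal terms
equal \<open>tr (S A S R)\<close>.
\<close>

lemma W2_sq_le_coupling:
  fixes A B S :: "real^'n^'n"
  assumes A: "A \<in> SPD" and B: "B \<in> SPD" and S: "S \<in> SPD"
  shows "W2_sq (S ** A ** S) B
    \<le> trace (S ** A ** S) + trace B - 2 * trace (S ** A ** transport A B)"
proof -
  define T where "T = transport A B"
  define A' where "A' = S ** A ** S"
  define R where "R = transport A' B"
  define Ri where "Ri = matrix_inv R"
  define a where "a = msqrt A"
  have A': "A' \<in> SPD" unfolding A'_def by (rule SPD_congruence[OF A S])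
  have T: "T \<in> SPD" "T ** A ** T = B"
    unfolding T_def by (rule transport_SPD[OF A B], rule transport_push[OF A B])
  have R: "R \<in> SPD" "R ** A' ** R = B"
    unfolding R_def by (rule transport_SPD[OF A' B], rule transport_push[OF A' B])
  have Ri: "R ** Ri = mat 1" "Ri ** R = mat 1" "Ri \<in> SPD"
    unfolding Ri_def by (rule SPD_inv[OF R(1)])+ (rule SPD_matrix_inv[OF R(1)])
  have a: "a \<in> SPD" "a ** a = A"
    unfolding a_def by (rule msqrt_SPD[OF A], rule msqrt_square[OF A])
  have sym: "transpose S = S" "transpose a = a" "transpose T = T" "transpose Ri = Ri"
    "transpose A = A"
    using S a(1) T(1) Ri(3) A by (simp_all add: SPD_sym)
  define X where "X = S ** a - Ri ** T ** a"
  have "0 * (norm X)\<^sup>2 \<le> trace (transpose X ** R ** X)"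
    by (rule trace_congruence_ge) (simp add: SPD_nonneg R(1))
  also have "transpose X ** R ** X = a ** S ** R ** S ** a - a ** S ** (R ** Ri) ** T ** a
      - a ** T ** (Ri ** R) ** S ** a + a ** T ** (Ri ** R) ** Ri ** T ** a"
    by (simp add: X_def transpose_expand sym mat_expand)
  also have "\<dots> = a ** S ** R ** S ** a - a ** S ** T ** a
      - a ** T ** S ** a + a ** T ** Ri ** T ** a"
    by (simp add: Ri(1,2))
  also have "trace \<dots> = trace (a ** (S ** R ** S ** a)) - trace (a ** (S ** T ** a))
      - trace (a ** (T ** S ** a)) + trace (a ** (T ** Ri ** T ** a))"
    by (simp add: mat_expand)
  also have "trace (a ** (S ** R ** S ** a)) = trace (A' ** R)"
  proof -
    have "trace (a ** (S ** R ** S ** a)) = trace ((S ** R) ** (S ** A))"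
      by (simp only: trace_mul_sym[of a] matrix_mul_assoc[symmetric] a(2))
    also have "\<dots> = trace (S ** (R ** (S ** A)))" by (simp only: matrix_mul_assoc)
    also have "\<dots> = trace (R ** (S ** A) ** S)" by (rule trace_mul_sym)
    also have "\<dots> = trace (R ** A')" by (simp only: A'_def matrix_mul_assoc)
    finally show ?thesis by (simp only: trace_mul_sym[of R])
  qed
  also have "trace (a ** (T ** Ri ** T ** a)) = trace (A' ** R)"
  proof -
    have "trace (a ** (T ** Ri ** T ** a)) = trace ((T ** Ri) ** (T ** A))"
      by (simp only: trace_mul_sym[of a] matrix_mul_assoc[symmetric] a(2))
    also have "\<dots> = trace (T ** (Ri ** (T ** A)))" by (simp only: matrix_mul_assoc)
    also have "\<dots> = trace (Ri ** (T ** A) ** T)" by (rule trace_mul_sym)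
    also have "\<dots> = trace (Ri ** (T ** A ** T))" by (simp only: matrix_mul_assoc)
    also have "\<dots> = trace ((Ri ** R) ** (A' ** R))"
      by (simp only: T(2) R(2)[symmetric] matrix_mul_assoc)
    finally show ?thesis by (simp add: Ri(2))
  qed
  also have "trace (a ** (S ** T ** a)) = trace (S ** A ** T)"
  proof -
    have "trace (a ** (S ** T ** a)) = trace (S ** T ** A)"
      by (simp only: trace_mul_sym[of a] matrix_mul_assoc[symmetric] a(2))
    also have "\<dots> = trace (transpose (S ** T ** A))" by (rule trace_transpose[symmetric])
    also have "\<dots> = trace ((A ** T) ** S)" by (simp add: matrix_transpose_mul sym matrix_mul_assoc)
    also have "\<dots> = trace (S ** (A ** T))" by (rule trace_mul_sym)
    finally show ?thesis by (simp only: matrix_mul_assoc)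
  qed
  also have "trace (a ** (T ** S ** a)) = trace (S ** A ** T)"
  proof -
    have "trace (a ** (T ** S ** a)) = trace (T ** (S ** A))"
      by (simp only: trace_mul_sym[of a] matrix_mul_assoc[symmetric] a(2))
    then show ?thesis by (simp only: trace_mul_sym[of T])
  qed
  finally have "trace (S ** A ** T) \<le> trace (A' ** R)" by simp
  moreover have "W2_sq A' B = trace A' + trace B - 2 * trace (A' ** R)"
    unfolding R_def by (rule W2_sq_transport[OF A' B])
  ultimately show ?thesis by (simp add: A'_def T_def)
qed

text \<open>
As a function of its first argument, the squared distance has Euclidean gradient \<open>I - T\<close> at \<open>A\<close>;
the last term is its exact Bregman divergence.  The identity rests on
\<open>tr (A T) = tr (B T\<inverse>) = tr (A' T' T\<inverse> T')\<close>.
\<close>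

lemma W2_sq_bregman:
  fixes A A' B :: "real^'n^'n"
  assumes A: "A \<in> SPD" and A': "A' \<in> SPD" and B: "B \<in> SPD"
  defines "D \<equiv> transport A' B - transport A B"
  shows "W2_sq A' B = W2_sq A B + trace ((mat 1 - transport A B) ** (A' - A))
    + trace (A' ** D ** matrix_inv (transport A B) ** D)"
proof -
  define T where "T = transport A B"
  define T' where "T' = transport A' B"
  define U where "U = matrix_inv T"
  have T: "T \<in> SPD" "T ** A ** T = B"
    unfolding T_def by (rule transport_SPD[OF A B], rule transport_push[OF A B])
  have T': "T' \<in> SPD" "T' ** A' ** T' = B"
    unfolding T'_def by (rule transport_SPD[OF A' B], rule transport_push[OF A' B])
  have U: "T ** U = mat 1" "U ** T = mat 1"
    unfolding U_def by (rule SPD_inv[OF T(1)])+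
  have "trace (A' ** D ** U ** D) = trace (A' ** T' ** U ** T' - A' ** T' ** (U ** T)
      - A' ** (T ** U) ** T' + A' ** (T ** U) ** T)"
    by (simp add: D_def T_def[symmetric] T'_def[symmetric] mat_expand)
  also have "\<dots> = trace (A' ** T' ** U ** T') - 2 * trace (A' ** T') + trace (A' ** T)"
    by (simp only: U mat_expand matrix_mul_rid)
  also have "trace (A' ** T' ** U ** T') = trace (A ** T)"
  proof -
    have "trace (A' ** T' ** U ** T') = trace (T' ** (A' ** T' ** U))" by (rule trace_mul_sym)
    also have "\<dots> = trace (T ** A ** T ** U)"
      by (simp only: T(2) T'(2) matrix_mul_assoc)
    also have "\<dots> = trace (T ** A ** (T ** U))" by (simp only: matrix_mul_assoc)
    finally show ?thesis by (simp add: U trace_mul_sym[of T])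
  qed
  finally have "trace (A' ** D ** U ** D)
    = trace (A ** T) - 2 * trace (A' ** T') + trace (A' ** T)" .
  moreover have "trace ((mat 1 - T) ** (A' - A)) = trace A' - trace A - trace (A' ** T) + trace (A ** T)"
    by (simp add: mat_expand trace_mul_sym[of T])
  ultimately show ?thesis
    unfolding W2_sq_transport[OF A B] W2_sq_transport[OF A' B] U_def T_def T'_def by simp
qed

text \<open>
The eigenvalue bounds are stated through the quadratic form, which passes through integrals and
congruences without diagonalising anything.
\<close>

definition cov_box :: "real \<Rightarrow> (real^'n^'n) set" where
  "cov_box k = {A. transpose A = A \<and>
     (\<forall>x. 1 / k * (x \<bullet> x) \<le> x \<bullet> (A *v x) \<and> x \<bullet> (A *v x) \<le> k * (x \<bullet> x))}"

lemma cov_box_lower: "A \<in> cov_box k \<Longrightarrow> 1 / k * (x \<bullet> x) \<le> x \<bullet> (A *v x)"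
  unfolding cov_box_def by blast

lemma cov_box_upper: "A \<in> cov_box k \<Longrightarrow> x \<bullet> (A *v x) \<le> k * (x \<bullet> x)"
  unfolding cov_box_def by blast

lemma cov_box_SPD: "A \<in> cov_box k \<Longrightarrow> 0 < k \<Longrightarrow> A \<in> SPD"
  by (rule SPD_I[of A "1/k"]) (auto simp: cov_box_def)

lemma form_bounds_imp_norm:
  fixes A :: "real^'n^'n"
  assumes sym: "transpose A = A" and k: "0 < k"
    and "\<And>x. 0 \<le> x \<bullet> (A *v x)" "\<And>x. x \<bullet> (A *v x) \<le> k * (x \<bullet> x)"
  shows "norm (A *v x) \<le> k * norm x"
proof -
  let ?q = "\<lambda>x y. x \<bullet> (A *v y)"
  let ?z = "A *v x"
  have "0 \<le> ?q (k *\<^sub>R x - ?z) (k *\<^sub>R x - ?z)" by (rule assms)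
  then have "2 * k * (?z \<bullet> ?z) \<le> k\<^sup>2 * ?q x x + ?q ?z ?z"
    by (simp add: vec_expand power2_eq_square symmetric_inner[OF sym, symmetric] algebra_simps)
  also have "\<dots> \<le> k\<^sup>2 * ?q x x + k * (?z \<bullet> ?z)"
    using assms(4)[of ?z] by simp
  finally have "k * (?z \<bullet> ?z) \<le> k\<^sup>2 * ?q x x" by simp
  then have "?z \<bullet> ?z \<le> k * ?q x x" using k by (simp add: power2_eq_square)
  also have "\<dots> \<le> k * (k * (x \<bullet> x))" using k by (intro mult_left_mono assms) simp
  finally have "(norm ?z)\<^sup>2 \<le> (k * norm x)\<^sup>2"
    by (simp add: power2_norm_eq_inner power_mult_distrib power2_eq_square[of k] mult.assoc)
  then show ?thesis by (rule power2_le_imp_le) (use k in simp)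
qed

lemma transport_norm_le:
  fixes A B :: "real^'n^'n"
  assumes "A \<in> SPD" "B \<in> SPD" "0 < p" "0 \<le> u"
    and "\<And>x. p * (x \<bullet> x) \<le> x \<bullet> (A *v x)" "\<And>x. x \<bullet> (B *v x) \<le> u * (x \<bullet> x)"
  shows "norm (transport A B *v x) \<le> sqrt (u / p) * norm x"
proof -
  have "p * (norm (transport A B *v x))\<^sup>2 \<le> u * (norm x)\<^sup>2"
    using assms(5)[of "transport A B *v x"] assms(6)[of x] transport_energy[OF assms(1,2), of x]
    by (simp add: power2_norm_eq_inner)
  then have "(norm (transport A B *v x))\<^sup>2 \<le> (sqrt (u / p) * norm x)\<^sup>2"
    using assms(3,4) by (simp add: power_mult_distrib field_simps)
  then show ?thesis
    by (rule power2_le_imp_le) (use assms in simp)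
qed

lemma transport_inv_norm_le:
  fixes A B :: "real^'n^'n"
  assumes A: "A \<in> cov_box k" and B: "B \<in> cov_box k" and k: "0 < k"
  shows "norm (matrix_inv (transport A B) *v x) \<le> k * norm x"
proof -
  note S = cov_box_SPD[OF A k] cov_box_SPD[OF B k]
  let ?y = "matrix_inv (transport A B) *v x"
  have x: "transport A B *v ?y = x"
    by (rule SPD_inv_vector[OF transport_SPD[OF S]])
  have "1 / k * (?y \<bullet> ?y) \<le> k * (x \<bullet> x)"
    using cov_box_lower[OF B, of ?y] cov_box_upper[OF A, of x] transport_energy[OF S, of ?y]
    unfolding x by linarith
  then have "(norm ?y)\<^sup>2 \<le> (k * norm x)\<^sup>2"
    using k by (simp add: power2_norm_eq_inner power_mult_distrib field_simps)
      (simp add: power2_eq_square mult_ac)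
  then show ?thesis by (rule power2_le_imp_le) (use k in simp)
qed

lemma SPD_inv_lower:
  fixes T :: "real^'n^'n"
  assumes T: "T \<in> SPD" and k: "0 < k" and up: "\<And>x. norm (T *v x) \<le> k * norm x"
  shows "1 / k * (x \<bullet> x) \<le> x \<bullet> (matrix_inv T *v x)"
proof -
  obtain e l where e: "norm e = 1" "matrix_inv T *v e = l *\<^sub>R e"
    and l: "\<And>y. l * (y \<bullet> y) \<le> y \<bullet> (matrix_inv T *v y)"
    by (rule min_eigenvector[OF SPD_sym[OF SPD_matrix_inv[OF T]]]) (rule that)
  have "0 \<le> l" using SPD_nonneg[OF SPD_matrix_inv[OF T], of e] e by (simp add: norm_eq_1)
  have "e = l *\<^sub>R (T *v e)"
    using SPD_inv_vector(1)[OF T, of e] e by (simp add: matvec.scaleR_right)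
  then have "1 = l * norm (T *v e)"
    using e \<open>0 \<le> l\<close> by (metis abs_of_nonneg norm_scaleR)
  also have "\<dots> \<le> l * k" using up[of e] e \<open>0 \<le> l\<close> by (simp add: mult_left_mono)
  finally have "1 / k \<le> l" using k by (simp add: field_simps)
  then show ?thesis using l[of x] by (smt (verit) inner_ge_zero mult_right_mono)
qed

lemma bregman_ge_transport_diff:
  fixes A A' B :: "real^'n^'n"
  assumes A: "A \<in> cov_box k" and A': "A' \<in> cov_box k" and B: "B \<in> cov_box k" and k: "0 < k"
    and D: "transpose D = D"
  shows "(norm D)\<^sup>2 / k\<^sup>2 \<le> trace (A' ** D ** matrix_inv (transport A B) ** D)"
proof -
  note S = cov_box_SPD[OF A k] cov_box_SPD[OF A' k] cov_box_SPD[OF B k]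
  let ?T = "transport A B"
  let ?U = "matrix_inv ?T"
  have T: "?T \<in> SPD" by (rule transport_SPD[OF S(1,3)])
  have U: "?U \<in> SPD" by (rule SPD_matrix_inv[OF T])
  define t where "t = msqrt ?U"
  have t: "t \<in> SPD" "t ** t = ?U" "transpose t = t"
    unfolding t_def using msqrt_SPD[OF U] msqrt_square[OF U] SPD_sym by blast+
  have "norm (?T *v x) \<le> k * norm x" for x
    using transport_norm_le[OF S(1,3), of "1/k" k x] cov_box_lower[OF A] cov_box_upper[OF B] k
    by (simp add: real_sqrt_mult)
  then have low: "1 / k * (x \<bullet> x) \<le> x \<bullet> (?U *v x)" for x
    by (rule SPD_inv_lower[OF T k])
  have "1 / k * (norm D)\<^sup>2 \<le> trace (transpose D ** ?U ** D)"
    by (rule trace_congruence_ge[OF low])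
  also have "\<dots> = (norm (t ** D))\<^sup>2"
    by (simp add: trace_transpose_mult_self[symmetric] matrix_transpose_mul t(2)[symmetric] t(3)
        matrix_mul_assoc)
  also have "norm (t ** D) = norm (D ** t)"
    by (metis D matrix_transpose_mul norm_transpose t(3))
  finally have "1 / k * (1 / k * (norm D)\<^sup>2) \<le> 1 / k * (norm (D ** t))\<^sup>2"
    using k by (intro mult_left_mono) auto
  also have "\<dots> \<le> trace (transpose (D ** t) ** A' ** (D ** t))"
    by (rule trace_congruence_ge[OF cov_box_lower[OF A']])
  also have "\<dots> = trace (t ** (D ** A' ** D ** t))"
    by (simp add: matrix_transpose_mul D t(3) matrix_mul_assoc)
  also have "\<dots> = trace (D ** (A' ** D ** ?U))"
    by (simp only: trace_mul_sym[of t] matrix_mul_assoc[symmetric] t(2))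
  also have "\<dots> = trace (A' ** D ** ?U ** D)" by (rule trace_mul_sym)
  finally show ?thesis by (simp add: power2_eq_square)
qed

lemma SPD_form_cauchy_schwarz:
  fixes B :: "real^'n^'n"
  assumes B: "B \<in> SPD" and x: "x \<bullet> (B *v x) \<le> a\<^sup>2" and y: "y \<bullet> (B *v y) \<le> b\<^sup>2"
    and "0 \<le> a" "0 \<le> b"
  shows "x \<bullet> (B *v y) \<le> a * b"
proof -
  define c where "c = msqrt B"
  have c: "c \<in> SPD" "c ** c = B" unfolding c_def using msqrt_SPD[OF B] msqrt_square[OF B] by auto
  have eq: "u \<bullet> (B *v v) = (c *v u) \<bullet> (c *v v)" for u v
    by (simp add: c(2)[symmetric] symmetric_inner[OF SPD_sym[OF c(1)]] matrix_vector_mul_assoc)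
  have "norm (c *v x) \<le> a" "norm (c *v y) \<le> b"
    using x y assms(4,5) by (auto simp: eq power2_norm_eq_inner[symmetric] intro: power2_le_imp_le)
  then show ?thesis
    unfolding eq by (intro order_trans[OF norm_cauchy_schwarz] mult_mono) (use assms in auto)
qed

text \<open>
With \<open>U\<close>, \<open>U'\<close> the inverses of the two transport maps, \<open>A = U B U\<close> and \<open>A' = U' B U'\<close>.
Interpolating through \<open>N = U' B U\<close> writes \<open>A - A'\<close> as \<open>U' D A + N D U'\<close>.  The operator norm of
\<open>N\<close> is at most \<open>k\<close> by the Cauchy-Schwarz inequality for the form \<open>B\<close>, whereas multiplying the
norms of its factors would only give \<open>k\<^sup>3\<close>.
\<close>

lemma norm_diff_le_transport_diff:
  fixes A A' B :: "real^'n^'n"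
  assumes A: "A \<in> cov_box k" and A': "A' \<in> cov_box k" and B: "B \<in> cov_box k" and k: "0 < k"
  shows "norm (A' - A) \<le> 2 * k\<^sup>2 * norm (transport A' B - transport A B)"
proof -
  note S = cov_box_SPD[OF A k] cov_box_SPD[OF A' k] cov_box_SPD[OF B k]
  define T where "T = transport A B"
  define T' where "T' = transport A' B"
  define D where "D = T' - T"
  define U where "U = matrix_inv T"
  define U' where "U' = matrix_inv T'"
  have T: "T \<in> SPD" "T ** A ** T = B"
    unfolding T_def by (rule transport_SPD[OF S(1,3)], rule transport_push[OF S(1,3)])
  have T': "T' \<in> SPD" "T' ** A' ** T' = B"
    unfolding T'_def by (rule transport_SPD[OF S(2,3)], rule transport_push[OF S(2,3)])
  have U: "T ** U = mat 1" "U ** T = mat 1" "U \<in> SPD"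
    unfolding U_def by (rule SPD_inv[OF T(1)])+ (rule SPD_matrix_inv[OF T(1)])
  have U': "T' ** U' = mat 1" "U' ** T' = mat 1" "U' \<in> SPD"
    unfolding U'_def by (rule SPD_inv[OF T'(1)])+ (rule SPD_matrix_inv[OF T'(1)])
  have sym: "transpose U = U" "transpose U' = U'" "transpose A = A" "transpose B = B"
    using U(3) U'(3) S by (simp_all add: SPD_sym)
  have UBU: "U ** B ** U = A"
  proof -
    have "U ** B ** U = (U ** T) ** A ** (T ** U)" by (simp only: T(2)[symmetric] matrix_mul_assoc)
    then show ?thesis by (simp add: U)
  qed
  have UBU': "U' ** B ** U' = A'"
  proof -
    have "U' ** B ** U' = (U' ** T') ** A' ** (T' ** U')"
      by (simp only: T'(2)[symmetric] matrix_mul_assoc)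
    then show ?thesis by (simp add: U')
  qed
  define N where "N = U' ** B ** U"
  have "U' ** D ** A = A - N"
  proof -
    have "U' ** D ** A = (U' ** T') ** A - U' ** T ** A" by (simp add: D_def mat_expand)
    also have "U' ** T ** A = U' ** (T ** A ** T) ** U"
      using U(1) by (simp add: matrix_mul_assoc[symmetric])
    finally show ?thesis by (simp add: U' T(2) N_def)
  qed
  moreover have "N ** D ** U' = N - A'"
  proof -
    have "N ** D ** U' = N ** (T' ** U') - N ** T ** U'" by (simp add: D_def mat_expand)
    also have "N ** T ** U' = U' ** B ** (U ** T) ** U'" by (simp add: N_def matrix_mul_assoc)
    finally show ?thesis by (simp add: U' U UBU')
  qed
  ultimately have eq: "A' - A = - (U' ** D ** A + N ** D ** U')" by simp
  have nU': "norm (U' *v v) \<le> k * norm v" for v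
    unfolding U'_def T'_def by (rule transport_inv_norm_le[OF A' B k])
  have nA: "norm (A *v v) \<le> k * norm v" for v
    by (rule form_bounds_imp_norm) (use sym k SPD_nonneg[OF S(1)] cov_box_upper[OF A] in auto)
  have nN: "norm (N *v v) \<le> k * norm v" for v
  proof (cases "N *v v = 0")
    case False
    let ?y = "N *v v"
    have "?y = U' *v (B *v (U *v v))"
      by (simp add: N_def matrix_vector_mul_assoc matrix_mul_assoc)
    then have "?y \<bullet> ?y = (U' *v ?y) \<bullet> (B *v (U *v v))"
      by (metis symmetric_inner[OF sym(2)])
    also have "\<dots> \<le> (sqrt k * norm ?y) * (sqrt k * norm v)"
    proof (rule SPD_form_cauchy_schwarz[OF S(3)])
      have "(U' *v y) \<bullet> (B *v (U' *v y)) = y \<bullet> (A' *v y)" for y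
        by (simp add: UBU'[symmetric] symmetric_inner[OF sym(2)] matrix_vector_mul_assoc matrix_mul_assoc)
      then show "(U' *v ?y) \<bullet> (B *v (U' *v ?y)) \<le> (sqrt k * norm ?y)\<^sup>2"
        using cov_box_upper[OF A', of ?y] k by (simp add: power_mult_distrib power2_norm_eq_inner)
      have "(U *v v) \<bullet> (B *v (U *v v)) = v \<bullet> (A *v v)"
        by (simp add: UBU[symmetric] symmetric_inner[OF sym(1)] matrix_vector_mul_assoc matrix_mul_assoc)
      then show "(U *v v) \<bullet> (B *v (U *v v)) \<le> (sqrt k * norm v)\<^sup>2"
        using cov_box_upper[OF A, of v] k by (simp add: power_mult_distrib power2_norm_eq_inner)
    qed (use k in simp_all)
    also have "\<dots> = norm ?y * (k * norm v)" using k by simp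
    finally have "norm ?y * norm ?y \<le> norm ?y * (k * norm v)"
      by (simp add: power2_norm_eq_inner[symmetric] power2_eq_square)
    then show ?thesis using False by simp
  qed (use k in simp)
  have "norm (U' ** D ** A) \<le> k * norm (U' ** D)"
    by (rule norm_matmul_le_right) (use nA sym k in auto)
  also have "\<dots> \<le> k * (k * norm D)"
    by (intro mult_left_mono norm_matmul_le_left) (use nU' k in auto)
  finally have 1: "norm (U' ** D ** A) \<le> k\<^sup>2 * norm D" by (simp add: power2_eq_square)
  have "norm (N ** D ** U') \<le> k * norm (N ** D)"
    by (rule norm_matmul_le_right) (use nU' sym k in auto)
  also have "\<dots> \<le> k * (k * norm D)"
    by (intro mult_left_mono norm_matmul_le_left) (use nN k in auto)
  finally have 2: "norm (N ** D ** U') \<le> k\<^sup>2 * norm D" by (simp add: power2_eq_square)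
  have "norm (A' - A) \<le> norm (U' ** D ** A) + norm (N ** D ** U')"
    unfolding eq norm_minus_cancel by (rule norm_triangle_ineq)
  with 1 2 have "norm (A' - A) \<le> 2 * k\<^sup>2 * norm D" by linarith
  then show ?thesis by (simp add: D_def T_def T'_def)
qed

lemma W2_sq_strongly_convex:
  fixes A A' B :: "real^'n^'n"
  assumes A: "A \<in> cov_box k" and A': "A' \<in> cov_box k" and B: "B \<in> cov_box k" and k: "0 < k"
  shows "W2_sq A B + trace ((mat 1 - transport A B) ** (A' - A)) + (norm (A' - A))\<^sup>2 / (4 * k ^ 6)
    \<le> W2_sq A' B"
proof -
  note S = cov_box_SPD[OF A k] cov_box_SPD[OF A' k] cov_box_SPD[OF B k]
  define D where "D = transport A' B - transport A B"
  have symD: "transpose D = D"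
    by (simp add: D_def transpose_expand SPD_sym[OF transport_SPD] S)
  have "(norm (A' - A))\<^sup>2 \<le> (2 * k\<^sup>2 * norm D)\<^sup>2"
    unfolding D_def using norm_diff_le_transport_diff[OF A A' B k] by (intro power_mono) auto
  also have "\<dots> = (4 * k ^ 6) * ((norm D)\<^sup>2 / k\<^sup>2)"
    using k by (simp add: power_mult_distrib field_simps)
  finally have "(norm (A' - A))\<^sup>2 / (4 * k ^ 6) \<le> (norm D)\<^sup>2 / k\<^sup>2"
    using k by (simp add: pos_divide_le_eq mult.commute)
  also have "\<dots> \<le> trace (A' ** D ** matrix_inv (transport A B) ** D)"
    by (rule bregman_ge_transport_diff[OF A A' B k symD])
  finally show ?thesis
    using W2_sq_bregman[OF S] by (simp add: D_def)
qed

section \<open>Supports, inverses and the entropy term\<close>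

text \<open>
By the Lindelof property, the complement of the support is covered by countably many open null sets.
\<close>

lemma AE_measure_support:
  fixes M :: "'a::second_countable_topology measure"
  assumes sets: "sets M = sets (restrict_space borel S)"
  shows "AE x in M. x \<in> measure_support M"
proof -
  define F where "F = {U. open U \<and> emeasure M (U \<inter> space M) = 0}"
  obtain F' where F': "F' \<subseteq> F" "countable F'" "\<Union>F' = \<Union>F"
    using Lindelof[of F] by (auto simp: F_def)
  have sp: "space M = S"
    using sets_eq_imp_space_eq[OF sets] by (simp add: space_restrict_space)
  have meas: "U \<inter> space M \<in> sets M" if "open U" for U
    unfolding sets sp sets_restrict_space
    using that by (intro image_eqI[of _ _ U]) (simp_all add: Int_commute)
  have "(\<Union>U\<in>F'. U \<inter> space M) \<in> null_sets M"
    using F'(1,2) by (intro null_sets_UN') (auto simp: F_def null_sets_def meas)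
  moreover have "{x \<in> space M. x \<notin> measure_support M} \<subseteq> (\<Union>U\<in>F'. U \<inter> space M)"
  proof
    fix x assume x: "x \<in> {x \<in> space M. x \<notin> measure_support M}"
    then obtain U where "open U" "x \<in> U" "emeasure M (U \<inter> space M) = 0"
      by (auto simp: measure_support_def zero_less_iff_neq_zero)
    then have "x \<in> \<Union>F" by (auto simp: F_def)
    then show "x \<in> (\<Union>U\<in>F'. U \<inter> space M)" using x F'(3) by auto
  qed
  ultimately show ?thesis by (rule AE_I')
qed

lemma cov_box_eigenvalues:
  fixes A :: "real^'n^'n"
  assumes A: "A \<in> SPD" and ev: "\<And>l. eigenvalue A l \<Longrightarrow> l \<in> {1 / k .. k}"
  shows "A \<in> cov_box k"
proof -
  obtain e l where e: "norm e = 1" "A *v e = l *\<^sub>R e"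
    and l: "\<And>y. l * (y \<bullet> y) \<le> y \<bullet> (A *v y)"
    by (rule min_eigenvector[OF SPD_sym[OF A]]) (rule that)
  obtain e' l' where e': "norm e' = 1" "A *v e' = l' *\<^sub>R e'"
    and l': "\<And>y. y \<bullet> (A *v y) \<le> l' * (y \<bullet> y)"
    by (rule max_eigenvector[OF SPD_sym[OF A]]) (rule that)
  have "eigenvalue A l" "eigenvalue A l'"
    unfolding eigenvalue_def using e e' by (metis norm_zero zero_neq_one)+
  then have "1 / k \<le> l" "l' \<le> k" using ev by auto
  then have "1 / k * (x \<bullet> x) \<le> l * (x \<bullet> x)" "l' * (x \<bullet> x) \<le> k * (x \<bullet> x)" for x :: "real^'n"
    by (simp_all only: mult_right_mono inner_ge_zero)
  then show ?thesis
    unfolding cov_box_def using l l' SPD_sym[OF A] by (blast intro: order_trans)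
qed

lemma inv_form_le:
  fixes A :: "real^'n^'n"
  assumes A: "A \<in> cov_box k" and k: "0 < k"
  shows "x \<bullet> (matrix_inv A *v x) \<le> k * (x \<bullet> x)"
proof -
  note S = cov_box_SPD[OF A k]
  let ?y = "matrix_inv A *v x"
  have x: "A *v ?y = x" by (rule SPD_inv_vector[OF S])
  have "0 \<le> (x - (1 / k) *\<^sub>R ?y) \<bullet> (x - (1 / k) *\<^sub>R ?y)" by simp
  then have "2 / k * (x \<bullet> ?y) \<le> x \<bullet> x + 1 / k * (1 / k * (?y \<bullet> ?y))"
    by (simp add: vec_expand inner_commute)
  also have "1 / k * (1 / k * (?y \<bullet> ?y)) \<le> 1 / k * (x \<bullet> ?y)"
    using cov_box_lower[OF A, of ?y] k unfolding x
    by (intro mult_left_mono) (auto simp: inner_commute)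
  finally have "1 / k * (x \<bullet> ?y) \<le> x \<bullet> x" by simp
  then show ?thesis using k by (simp add: field_simps)
qed

text \<open>
Convexity of \<open>- ln det\<close>, reduced by congruence with \<open>A\<^bsup>-1/2\<^esup>\<close> to \<open>ln det X \<le> tr X - n\<close>.
\<close>

lemma KL_std_tangent:
  fixes A A' :: "real^'n^'n"
  assumes A: "A \<in> SPD" and A': "A' \<in> SPD"
  shows "KL_std A + trace ((mat 1 - matrix_inv A) ** (A' - A)) / 2 \<le> KL_std A'"
proof -
  define R where "R = msqrt (matrix_inv A)"
  have iA: "matrix_inv A \<in> SPD" by (rule SPD_matrix_inv[OF A])
  have R: "R \<in> SPD" "R ** R = matrix_inv A"
    unfolding R_def by (rule msqrt_SPD[OF iA], rule msqrt_square[OF iA])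
  have "det (matrix_inv A) * det A = 1"
    using SPD_inv(2)[OF A] by (metis det_I det_mul)
  then have dA: "det R * det R * det A = 1"
    by (simp add: R(2)[symmetric] det_mul)
  have "det (R ** A' ** R) * det A = det A' * (det R * det R * det A)"
    by (simp add: det_mul mult_ac)
  then have "det (R ** A' ** R) * det A = det A'" by (simp add: dA)
  moreover have "0 < det (R ** A' ** R)" by (rule det_SPD_pos[OF SPD_congruence[OF A' R(1)]])
  ultimately have "ln (det A') = ln (det (R ** A' ** R)) + ln (det A)"
    using det_SPD_pos[OF A] by (metis ln_mult_pos)
  also have "ln (det (R ** A' ** R)) \<le> trace (R ** A' ** R) - real CARD('n)"
    by (rule ln_det_le_trace[OF SPD_congruence[OF A' R(1)]])
  also have "trace (R ** A' ** R) = trace (matrix_inv A ** A')"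
    by (simp only: R(2)[symmetric] trace_mul_sym[of _ R] matrix_mul_assoc)
  finally have "ln (det A') \<le> trace (matrix_inv A ** A') - real CARD('n) + ln (det A)" by simp
  moreover have "trace ((mat 1 - matrix_inv A) ** (A' - A))
      = trace A' - trace A - trace (matrix_inv A ** A') + real CARD('n)"
    by (simp add: mat_expand SPD_inv[OF A] trace_I)
  ultimately show ?thesis by (simp add: KL_std_def field_simps)
qed

section \<open>The functional and its Wasserstein gradient\<close>

locale random_covariance = prob_space P for P :: "(real^'n^'n) measure" +
  fixes k \<gamma> :: real
  assumes sets_P: "sets P = sets (restrict_space borel SPD)"
    and AE_box: "AE B in P. B \<in> cov_box k"
    and k_ge_1: "1 \<le> k"
    and gamma_pos: "0 < \<gamma>"
begin

lemma k_pos: "0 < k" using k_ge_1 by simp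

lemma space_P: "space P = SPD"
  using sets_eq_imp_space_eq[OF sets_P] by (simp add: space_restrict_space)

definition mean_transport :: "real^'n^'n \<Rightarrow> real^'n^'n" where
  "mean_transport A = (\<integral>B. transport A B \<partial>P)"

text \<open>
The gradient in the Wasserstein geometry.  It is twice the Euclidean gradient, which is why
\<open>F_strongly_convex\<close> pairs it with the displacement with a factor 1/2.
\<close>

definition grad :: "real^'n^'n \<Rightarrow> real^'n^'n" where
  "grad A = (1 + \<gamma>) *\<^sub>R mat 1 - mean_transport A - \<gamma> *\<^sub>R matrix_inv A"

abbreviation F :: "real^'n^'n \<Rightarrow> real" where
  "F \<equiv> barycenter_functional P \<gamma>"

lemma rgd_factor_eq_grad: "rgd_factor P \<gamma> \<eta> A = mat 1 - \<eta> *\<^sub>R grad A"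
  by (simp add: rgd_factor_def grad_def mean_transport_def algebra_simps)

lemma measurable_SPD_continuous:
  fixes f :: "real^'n^'n \<Rightarrow> 'b::topological_space"
  shows "continuous_on SPD f \<Longrightarrow> f \<in> borel_measurable P"
  using borel_measurable_continuous_on_restrict measurable_cong_sets[OF sets_P refl] by blast

lemma measurable_transport:
  assumes A: "A \<in> SPD"
  shows "transport A \<in> borel_measurable P"
proof (rule measurable_SPD_continuous)
  define R where "R = msqrt (matrix_inv A)"
  define R' where "R' = matrix_inv R"
  have R': "R' \<in> SPD"
    unfolding R'_def R_def by (intro SPD_matrix_inv msqrt_SPD A)
  have "continuous_on SPD (\<lambda>B. R' ** B ** R')"
    by (intro matmul.continuous_on continuous_on_const continuous_on_id)
  moreover have "(\<lambda>B. R' ** B ** R') ` SPD \<subseteq> SPD" using SPD_congruence R' by blast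
  ultimately have "continuous_on SPD (\<lambda>B. msqrt (R' ** B ** R'))"
    by (rule continuous_on_compose2[OF continuous_on_msqrt])
  then have "continuous_on SPD (\<lambda>B. R ** msqrt (R' ** B ** R') ** R)"
    by (intro matmul.continuous_on continuous_on_const)
  then show "continuous_on SPD (transport A)"
    by (simp add: GM_def Let_def R_def R'_def)
qed

lemma integrable_transport:
  assumes A: "A \<in> SPD"
  shows "integrable P (transport A)"
proof -
  obtain c where c: "0 < c" "\<And>x. c * (x \<bullet> x) \<le> x \<bullet> (A *v x)"
    by (rule SPD_lower_bound[OF A]) (rule that)
  have "AE B in P. norm (transport A B) \<le> sqrt (k / c) * norm (mat 1 :: real^'n^'n)"
    using AE_box
  proof eventually_elim
    case (elim B)
    have "norm (transport A B ** mat 1) \<le> sqrt (k / c) * norm (mat 1 :: real^'n^'n)"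
    proof (rule norm_matmul_le_left)
      show "norm (transport A B *v v) \<le> sqrt (k / c) * norm v" for v
        using transport_norm_le[OF A cov_box_SPD[OF elim k_pos] c(1)] c(2) k_pos
          cov_box_upper[OF elim] by simp
    qed (use c k_pos in simp)
    then show ?case by simp
  qed
  then show ?thesis by (rule integrable_const_bound) (rule measurable_transport[OF A])
qed

lemma integral_transport_linear:
  assumes "A \<in> SPD" "bounded_linear L"
  shows "(\<integral>B. L (transport A B) \<partial>P) = L (mean_transport A)"
    "integrable P (\<lambda>B. L (transport A B))"
  using integral_bounded_linear[OF assms(2) integrable_transport[OF assms(1)]]
    integrable_bounded_linear[OF assms(2) integrable_transport[OF assms(1)]]
  by (simp_all add: mean_transport_def)

lemma mean_transport_functional_le:
  fixes L :: "real^'n^'n \<Rightarrow> real"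
  assumes A: "A \<in> SPD" and L: "bounded_linear L"
    and le: "\<And>B. B \<in> cov_box k \<Longrightarrow> L (transport A B) \<le> c"
  shows "L (mean_transport A) \<le> c"
proof -
  have *: "AE B in P. L (transport A B) \<le> c"
    using AE_box by eventually_elim (rule le)
  have "(\<integral>B. L (transport A B) \<partial>P) \<le> c"
    by (rule integral_le_const[OF integral_transport_linear(2)[OF A L] *])
  then show ?thesis by (simp add: integral_transport_linear[OF A L])
qed

lemma mean_transport_functional_ge:
  fixes L :: "real^'n^'n \<Rightarrow> real"
  assumes A: "A \<in> SPD" and L: "bounded_linear L"
    and le: "\<And>B. B \<in> cov_box k \<Longrightarrow> c \<le> L (transport A B)"
  shows "c \<le> L (mean_transport A)"
proof -
  have *: "AE B in P. c \<le> L (transport A B)"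
    using AE_box by eventually_elim (rule le)
  have "c \<le> (\<integral>B. L (transport A B) \<partial>P)"
    by (rule integral_ge_const[OF integral_transport_linear(2)[OF A L] *])
  then show ?thesis by (simp add: integral_transport_linear[OF A L])
qed

lemma bounded_linear_form: "bounded_linear (\<lambda>M :: real^'n^'n. x \<bullet> (M *v y))"
  by (intro bounded_linear_inner_right_comp matvec.bounded_linear_left)

lemma mean_transport_sym:
  assumes A: "A \<in> SPD"
  shows "transpose (mean_transport A) = mean_transport A"
proof -
  have "transpose (mean_transport A) = (\<integral>B. transpose (transport A B) \<partial>P)"
    by (rule integral_transport_linear(1)[OF A bounded_linear_transpose, symmetric])
  also have "\<dots> = mean_transport A"
    unfolding mean_transport_def
    by (rule Bochner_Integration.integral_cong) (auto simp: space_P SPD_sym transport_SPD A)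
  finally show ?thesis .
qed

lemma mean_transport_nonneg:
  assumes A: "A \<in> SPD"
  shows "0 \<le> x \<bullet> (mean_transport A *v x)"
  by (rule mean_transport_functional_ge[OF A bounded_linear_form])
    (rule SPD_nonneg[OF transport_SPD[OF A cov_box_SPD[OF _ k_pos]]])

lemma grad_sym:
  assumes A: "A \<in> SPD"
  shows "transpose (grad A) = grad A"
  by (simp add: grad_def transpose_expand mean_transport_sym[OF A] SPD_sym[OF SPD_matrix_inv[OF A]])

lemma integrable_trace: "integrable P trace"
proof (rule integrable_const_bound)
  show "AE B in P. norm (trace B) \<le> norm (mat 1 :: real^'n^'n) * (k * norm (mat 1 :: real^'n^'n))"
    using AE_box
  proof eventually_elim
    case (elim B)
    have "norm (B ** mat 1) \<le> k * norm (mat 1 :: real^'n^'n)"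
    proof (rule norm_matmul_le_left)
      show "norm (B *v v) \<le> k * norm v" for v
        by (rule form_bounds_imp_norm)
          (use cov_box_SPD[OF elim k_pos] cov_box_upper[OF elim] k_pos
            in \<open>auto simp: SPD_sym SPD_nonneg\<close>)
    qed (use k_pos in simp)
    then have B: "norm B \<le> k * norm (mat 1 :: real^'n^'n)" by simp
    have "norm (trace B) = \<bar>mat 1 \<bullet> B\<bar>" by (simp add: inner_symmetric_eq_trace)
    also have "\<dots> \<le> norm (mat 1 :: real^'n^'n) * norm B" by (rule Cauchy_Schwarz_ineq2)
    also have "\<dots> \<le> norm (mat 1 :: real^'n^'n) * (k * norm (mat 1 :: real^'n^'n))"
      by (intro mult_left_mono B) simp
    finally show ?case .
  qed
  show "trace \<in> borel_measurable P"
    by (rule measurable_SPD_continuous) (rule linear_continuous_on[OF bounded_linear_trace])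
qed

lemma bounded_linear_trace_mult: "bounded_linear (\<lambda>M :: real^'n^'n. trace (X ** M))"
  by (rule bounded_linear_compose[OF bounded_linear_trace matmul.bounded_linear_right])

text \<open>
With \<open>X = S A\<close> and \<open>c = tr (S A S)\<close> the integrand is the coupling cost bounding the distance from
\<open>S A S\<close> to \<open>B\<close>; the case \<open>S = I\<close> is the squared distance itself.
\<close>

lemma integral_coupling_cost:
  assumes A: "A \<in> SPD"
  shows "integrable P (\<lambda>B. c + trace B - 2 * trace (X ** transport A B))"
    "(\<integral>B. c + trace B - 2 * trace (X ** transport A B) \<partial>P)
      = c + (\<integral>B. trace B \<partial>P) - 2 * trace (X ** mean_transport A)"
  using integral_transport_linear[OF A bounded_linear_trace_mult, of X] integrable_trace
  by (simp_all add: prob_space)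

lemma integral_W2_sq:
  assumes A: "A \<in> SPD"
  shows "integrable P (W2_sq A)"
    "(\<integral>B. W2_sq A B \<partial>P) = trace A + (\<integral>B. trace B \<partial>P) - 2 * trace (A ** mean_transport A)"
proof -
  have eq: "W2_sq A B = trace A + trace B - 2 * trace (A ** transport A B)" if "B \<in> space P" for B
    using W2_sq_transport[OF A] that by (simp add: space_P)
  show "integrable P (W2_sq A)"
    using integral_coupling_cost(1)[OF A, of "trace A" A] eq
    by (subst Bochner_Integration.integrable_cong[OF refl eq]) auto
  show "(\<integral>B. W2_sq A B \<partial>P) = trace A + (\<integral>B. trace B \<partial>P) - 2 * trace (A ** mean_transport A)"
    using integral_coupling_cost(2)[OF A, of "trace A" A]
    by (subst Bochner_Integration.integral_cong[OF refl eq]) auto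
qed

section \<open>Descent\<close>

lemma step_factor_ge_half:
  assumes A: "A \<in> SPD" and eta: "0 \<le> \<eta>" "\<eta> * (1 + \<gamma>) \<le> 1 / 2"
  shows "1 / 2 * (x \<bullet> x) \<le> x \<bullet> ((mat 1 - \<eta> *\<^sub>R grad A) *v x)"
proof -
  have "x \<bullet> (grad A *v x) \<le> (1 + \<gamma>) * (x \<bullet> x)"
    using mean_transport_nonneg[OF A, of x]
      mult_nonneg_nonneg[OF less_imp_le[OF gamma_pos] SPD_nonneg[OF SPD_matrix_inv[OF A], of x]]
    by (simp add: grad_def vec_expand)
  then have "\<eta> * (x \<bullet> (grad A *v x)) \<le> \<eta> * (1 + \<gamma>) * (x \<bullet> x)"
    using eta(1) by (simp add: mult_left_mono mult.assoc)
  also have "\<dots> \<le> 1 / 2 * (x \<bullet> x)" using eta(2) by (intro mult_right_mono) auto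
  finally show ?thesis by (simp add: vec_expand)
qed

lemma step_factor_SPD:
  assumes A: "A \<in> SPD" and eta: "0 \<le> \<eta>" "\<eta> * (1 + \<gamma>) \<le> 1 / 2"
  shows "mat 1 - \<eta> *\<^sub>R grad A \<in> SPD"
  by (rule SPD_I[OF _ _ step_factor_ge_half[OF assms]])
    (simp_all add: transpose_expand grad_sym[OF A])

text \<open>
The two bounds \<open>W2_sq_le_coupling\<close> and \<open>neg_ln_det_le_quadratic\<close> are tangent at \<open>\<eta> = 0\<close>.
Their first-order terms add up to \<open>- \<eta> tr (G A G)\<close> because
\<open>G A G = (1 + \<gamma>) G A - G A M - \<gamma> G\<close>.
\<close>

lemma descent:
  fixes A :: "real^'n^'n"
  assumes A: "A \<in> SPD" and eta: "0 \<le> \<eta>" "\<eta> * (1 + \<gamma>) \<le> 1 / 2"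
  defines "G \<equiv> grad A"
  defines "S \<equiv> mat 1 - \<eta> *\<^sub>R G"
  shows "F (S ** A ** S) \<le> F A - \<eta> * trace (G ** A ** G)
    + \<eta>\<^sup>2 * ((1 + \<gamma>) / 2 * trace (G ** A ** G) + 2 * \<gamma> * (norm G)\<^sup>2)"
proof -
  define M where "M = mean_transport A"
  define e where "e = trace (G ** A ** G)"
  have S: "S \<in> SPD" unfolding S_def G_def by (rule step_factor_SPD[OF A eta])
  have SAS: "S ** A ** S \<in> SPD" by (rule SPD_congruence[OF A S])
  have "(\<integral>B. W2_sq (S ** A ** S) B \<partial>P)
      \<le> (\<integral>B. trace (S ** A ** S) + trace B - 2 * trace ((S ** A) ** transport A B) \<partial>P)"
    by (rule integral_mono[OF integral_W2_sq(1)[OF SAS] integral_coupling_cost(1)[OF A]])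
      (use W2_sq_le_coupling[OF A _ S] in \<open>simp add: space_P\<close>)
  also have "\<dots> = trace (S ** A ** S) + (\<integral>B. trace B \<partial>P) - 2 * trace (S ** A ** M)"
    unfolding M_def by (rule integral_coupling_cost(2)[OF A])
  finally have W: "(\<integral>B. W2_sq (S ** A ** S) B \<partial>P) \<le> (\<integral>B. W2_sq A B \<partial>P)
      + (trace (S ** A ** S) - trace A) + 2 * (trace (A ** M) - trace (S ** A ** M))"
    by (simp add: integral_W2_sq(2)[OF A] M_def)
  have trSAS: "trace (S ** A ** S) = trace A - 2 * \<eta> * trace (G ** A) + \<eta>\<^sup>2 * e"
    by (simp add: S_def mat_expand e_def power2_eq_square trace_mul_sym[of A G] algebra_simps)
  have trSAM: "trace (S ** A ** M) = trace (A ** M) - \<eta> * trace (G ** A ** M)"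
    by (simp add: S_def mat_expand)
  have "det (S ** A ** S) = det S * det S * det A" by (simp add: det_mul)
  then have "ln (det (S ** A ** S)) = 2 * ln (det S) + ln (det A)"
    using det_SPD_pos[OF S] det_SPD_pos[OF A] by (simp add: ln_mult_pos)
  moreover have "- ln (det S) \<le> trace (mat 1 - S) + 2 * (norm (mat 1 - S))\<^sup>2"
    by (rule neg_ln_det_le_quadratic[OF SPD_sym[OF S]])
      (unfold S_def G_def, rule step_factor_ge_half[OF A eta])
  moreover have "trace (mat 1 - S) = \<eta> * trace G" by (simp add: S_def mat_expand)
  moreover have "(norm (mat 1 - S))\<^sup>2 = \<eta>\<^sup>2 * (norm G)\<^sup>2" by (simp add: S_def power_mult_distrib)
  ultimately have "KL_std (S ** A ** S)
      \<le> KL_std A + (trace (S ** A ** S) - trace A) / 2 + (\<eta> * trace G + 2 * \<eta>\<^sup>2 * (norm G)\<^sup>2)"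
    by (simp add: KL_std_def field_simps)
  then have KL: "\<gamma> * KL_std (S ** A ** S)
      \<le> \<gamma> * (KL_std A + (trace (S ** A ** S) - trace A) / 2 + (\<eta> * trace G + 2 * \<eta>\<^sup>2 * (norm G)\<^sup>2))"
    using gamma_pos by (intro mult_left_mono) auto
  have eq: "e = (1 + \<gamma>) * trace (G ** A) - trace (G ** A ** M) - \<gamma> * trace G"
  proof -
    have "e = trace (G ** A ** ((1 + \<gamma>) *\<^sub>R mat 1 - M - \<gamma> *\<^sub>R matrix_inv A))"
      by (simp add: e_def G_def grad_def M_def)
    also have "\<dots> = (1 + \<gamma>) * trace (G ** A) - trace (G ** A ** M)
        - \<gamma> * trace (G ** (A ** matrix_inv A))"
      by (simp add: mat_expand)
    finally show ?thesis by (simp add: SPD_inv[OF A])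
  qed
  have "F (S ** A ** S) \<le> 1 / 2 * ((\<integral>B. W2_sq A B \<partial>P)
      + (trace (S ** A ** S) - trace A) + 2 * (trace (A ** M) - trace (S ** A ** M)))
      + \<gamma> * (KL_std A + (trace (S ** A ** S) - trace A) / 2 + (\<eta> * trace G + 2 * \<eta>\<^sup>2 * (norm G)\<^sup>2))"
    unfolding barycenter_functional_def by (intro add_mono mult_left_mono W KL) simp
  also have "\<dots> = 1 / 2 * (\<integral>B. W2_sq A B \<partial>P) + \<gamma> * KL_std A
      - \<eta> * ((1 + \<gamma>) * trace (G ** A) - trace (G ** A ** M) - \<gamma> * trace G)
      + \<eta>\<^sup>2 * ((1 + \<gamma>) / 2 * e + 2 * \<gamma> * (norm G)\<^sup>2)"
    unfolding trSAS trSAM by (simp add: field_simps)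
  also have "\<dots> = F A - \<eta> * e + \<eta>\<^sup>2 * ((1 + \<gamma>) / 2 * e + 2 * \<gamma> * (norm G)\<^sup>2)"
    unfolding barycenter_functional_def eq[symmetric] ..
  finally show ?thesis by (simp only: e_def)
qed

lemma energy_ge:
  assumes A: "A \<in> SPD" and low: "\<And>x. c * (x \<bullet> x) \<le> x \<bullet> (A *v x)"
  shows "c * (norm (grad A))\<^sup>2 \<le> trace (grad A ** A ** grad A)"
  using trace_congruence_ge[OF low, of "grad A"] by (simp add: grad_sym[OF A])

section \<open>Eigenvalue bounds along the iteration\<close>

lemma mean_transport_lower:
  assumes A: "A \<in> SPD" and p: "0 \<le> p" and low: "\<And>x. p * (x \<bullet> x) \<le> x \<bullet> (A *v x)"
  shows "sqrt (p / k) * (x \<bullet> (matrix_inv A *v x)) \<le> x \<bullet> (mean_transport A *v x)"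
proof (rule mean_transport_functional_ge[OF A bounded_linear_form])
  fix B :: "real^'n^'n" assume B: "B \<in> cov_box k"
  show "sqrt (p / k) * (x \<bullet> (matrix_inv A *v x)) \<le> x \<bullet> (transport A B *v x)"
    using transport_lower_bound[OF A cov_box_SPD[OF B k_pos] p _ low cov_box_lower[OF B], of x] k_pos
    by simp
qed

text \<open>
Put \<open>c = 1/k\<close> and \<open>s = 1 - \<eta> (1 + \<gamma>)\<close>.  Since \<open>(S - c A\<inverse>) A (S - c A\<inverse>) \<ge> 0\<close>, it suffices
to bound \<open>2 c S - c\<^sup>2 A\<inverse>\<close>.  From \<open>S \<ge> s I + (1 - s) c A\<inverse>\<close> one is left with
\<open>(2 s - 1) c (I - c A\<inverse>) \<ge> 0\<close>, which is where the step size restriction \<open>s \<ge> 1/2\<close> enters.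
Going through this linear minorant avoids comparing squares of matrices, which the Loewner order
does not permit.
\<close>

lemma step_lower_bound:
  assumes A: "A \<in> cov_box k" and eta: "0 \<le> \<eta>" "\<eta> * (1 + \<gamma>) \<le> 1 / 2"
  defines "S \<equiv> mat 1 - \<eta> *\<^sub>R grad A"
  shows "1 / k * (x \<bullet> x) \<le> (S *v x) \<bullet> (A *v (S *v x))"
proof -
  note SA = cov_box_SPD[OF A k_pos]
  define c where "c = 1 / k"
  define s where "s = 1 - \<eta> * (1 + \<gamma>)"
  define a where "a = x \<bullet> (matrix_inv A *v x)"
  have c: "0 < c" "c \<le> 1" using k_ge_1 by (auto simp: c_def)
  have s: "1 / 2 \<le> s" using eta by (simp add: s_def)
  have a: "0 \<le> a" unfolding a_def by (rule SPD_nonneg[OF SPD_matrix_inv[OF SA]])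
  have ca: "c * a \<le> x \<bullet> x"
    using inv_form_le[OF A k_pos, of x] k_pos by (simp add: c_def a_def field_simps)
  have "sqrt (1 / k / k) = c" using k_pos by (simp add: c_def real_sqrt_divide)
  then have M: "c * a \<le> x \<bullet> (mean_transport A *v x)"
    using mean_transport_lower[OF SA _ cov_box_lower[OF A], of x] k_pos by (simp add: a_def)
  have "c * a \<le> a" using a c by (simp add: mult_left_le_one_le)
  have "x \<bullet> (S *v x) = s * (x \<bullet> x) + \<eta> * (x \<bullet> (mean_transport A *v x)) + \<eta> * \<gamma> * a"
    by (simp add: S_def grad_def vec_expand s_def a_def algebra_simps)
  also have "\<dots> \<ge> s * (x \<bullet> x) + \<eta> * (c * a) + \<eta> * \<gamma> * (c * a)"
    using M \<open>c * a \<le> a\<close> eta(1) gamma_pos by (intro add_mono order_refl mult_left_mono) auto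
  finally have xS: "s * (x \<bullet> x) + (1 - s) * (c * a) \<le> x \<bullet> (S *v x)"
    by (simp add: s_def algebra_simps)
  define y where "y = S *v x - c *\<^sub>R (matrix_inv A *v x)"
  have "0 \<le> y \<bullet> (A *v y)" by (rule SPD_nonneg[OF SA])
  also have "y \<bullet> (A *v y) = (S *v x) \<bullet> (A *v (S *v x)) - 2 * c * (x \<bullet> (S *v x)) + c * (c * a)"
  proof -
    have "(matrix_inv A *v x) \<bullet> (A *v (S *v x)) = x \<bullet> (S *v x)"
      by (simp add: symmetric_inner[OF SPD_sym[OF SA], symmetric] SPD_inv_vector[OF SA])
    then show ?thesis
      by (simp add: y_def vec_expand SPD_inv_vector[OF SA] a_def inner_commute algebra_simps)
  qed
  finally have "2 * c * (x \<bullet> (S *v x)) - c * (c * a) \<le> (S *v x) \<bullet> (A *v (S *v x))" by simp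
  moreover have "2 * c * (s * (x \<bullet> x) + (1 - s) * (c * a)) \<le> 2 * c * (x \<bullet> (S *v x))"
    using xS c by (intro mult_left_mono) auto
  moreover have "0 \<le> (2 * s - 1) * c * (x \<bullet> x - c * a)"
    using s c ca by simp
  ultimately have "c * (x \<bullet> x) \<le> (S *v x) \<bullet> (A *v (S *v x))"
    by (simp add: algebra_simps)
  then show ?thesis by (simp add: c_def)
qed

text \<open>
With \<open>a = A\<^bsup>1/2\<^esup>\<close>, the vector \<open>a S x\<close> is a convex combination of \<open>a x\<close>, \<open>a M x\<close> and
\<open>a A\<inverse> x\<close>, each of length at most \<open>sqrt k |x|\<close>.
\<close>

lemma step_upper_bound:
  assumes A: "A \<in> cov_box k" and eta: "0 \<le> \<eta>" "\<eta> * (1 + \<gamma>) \<le> 1 / 2"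
  defines "S \<equiv> mat 1 - \<eta> *\<^sub>R grad A"
  shows "(S *v x) \<bullet> (A *v (S *v x)) \<le> k * (x \<bullet> x)"
proof -
  note SA = cov_box_SPD[OF A k_pos]
  define M where "M = mean_transport A"
  define a where "a = msqrt A"
  have a: "a \<in> SPD" "a ** a = A" unfolding a_def using msqrt_SPD[OF SA] msqrt_square[OF SA] by auto
  have form: "y \<bullet> (A *v y) = (norm (a *v y))\<^sup>2" for y
    by (simp add: a(2)[symmetric] symmetric_inner[OF SPD_sym[OF a(1)]] matrix_vector_mul_assoc
        power2_norm_eq_inner)
  define r where "r = sqrt k * norm x"
  have r2: "r\<^sup>2 = k * (x \<bullet> x)" using k_pos by (simp add: r_def power_mult_distrib power2_norm_eq_inner)
  have r0: "0 \<le> r" using k_pos by (simp add: r_def)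
  have "(norm (a *v x))\<^sup>2 \<le> r\<^sup>2" using cov_box_upper[OF A, of x] by (simp add: form r2)
  then have n1: "norm (a *v x) \<le> r" using r0 by (rule power2_le_imp_le)
  have "(norm (a *v (matrix_inv A *v x)))\<^sup>2 \<le> r\<^sup>2"
    using inv_form_le[OF A k_pos, of x]
    by (simp add: form[symmetric] SPD_inv_vector[OF SA] r2 inner_commute)
  then have n2: "norm (a *v (matrix_inv A *v x)) \<le> r" using r0 by (rule power2_le_imp_le)
  \<comment> \<open>duality avoids integrating a norm: bound \<open>|a M x|\<^sup>2\<close> as the mean of \<open>T\<^sub>B x\<close> paired with \<open>A M x\<close>\<close>
  have n3: "norm (a *v (M *v x)) \<le> r"
  proof -
    let ?N = "norm (a *v (M *v x))"
    have "(A *v (M *v x)) \<bullet> (mean_transport A *v x) \<le> r * ?N"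
    proof (rule mean_transport_functional_le[OF SA bounded_linear_form])
      fix B :: "real^'n^'n" assume B: "B \<in> cov_box k"
      have "(transport A B *v x) \<bullet> (A *v (M *v x)) \<le> r * ?N"
      proof (rule SPD_form_cauchy_schwarz[OF SA])
        show "(transport A B *v x) \<bullet> (A *v (transport A B *v x)) \<le> r\<^sup>2"
          using cov_box_upper[OF B, of x] transport_energy[OF SA cov_box_SPD[OF B k_pos], of x]
          by (simp add: r2)
      qed (use r0 form in auto)
      then show "(A *v (M *v x)) \<bullet> (transport A B *v x) \<le> r * ?N" by (simp add: inner_commute)
    qed
    then have "?N * ?N \<le> r * ?N"
      using form[of "M *v x"] by (simp add: M_def[symmetric] inner_commute power2_eq_square)
    then show ?thesis using r0 by (cases "?N = 0") (auto simp: mult_le_cancel_right)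
  qed
  have "a *v (S *v x) = (1 - \<eta> * (1 + \<gamma>)) *\<^sub>R (a *v x) + \<eta> *\<^sub>R (a *v (M *v x))
      + (\<eta> * \<gamma>) *\<^sub>R (a *v (matrix_inv A *v x))"
    by (simp add: S_def grad_def M_def vec_expand algebra_simps)
  then have "norm (a *v (S *v x)) \<le> norm ((1 - \<eta> * (1 + \<gamma>)) *\<^sub>R (a *v x))
      + norm (\<eta> *\<^sub>R (a *v (M *v x))) + norm ((\<eta> * \<gamma>) *\<^sub>R (a *v (matrix_inv A *v x)))"
    by (simp only:) (intro order_trans[OF norm_triangle_ineq] add_right_mono norm_triangle_ineq)
  also have "\<dots> = (1 - \<eta> * (1 + \<gamma>)) * norm (a *v x)
      + \<eta> * norm (a *v (M *v x)) + \<eta> * \<gamma> * norm (a *v (matrix_inv A *v x))"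
    using eta gamma_pos by simp
  also have "\<dots> \<le> (1 - \<eta> * (1 + \<gamma>)) * r + \<eta> * r + \<eta> * \<gamma> * r"
    using eta gamma_pos by (intro add_mono mult_left_mono n1 n2 n3) auto
  also have "\<dots> = r" by (simp add: algebra_simps)
  finally have "(norm (a *v (S *v x)))\<^sup>2 \<le> r\<^sup>2" by (rule power_mono) simp
  then show ?thesis by (simp add: form r2)
qed

lemma step_in_box:
  assumes A: "A \<in> cov_box k" and eta: "0 \<le> \<eta>" "\<eta> * (1 + \<gamma>) \<le> 1 / 2"
  defines "S \<equiv> mat 1 - \<eta> *\<^sub>R grad A"
  shows "S ** A ** S \<in> cov_box k"
proof -
  note SA = cov_box_SPD[OF A k_pos]
  have S: "S \<in> SPD" unfolding S_def by (rule step_factor_SPD[OF SA eta])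
  have "x \<bullet> ((S ** A ** S) *v x) = (S *v x) \<bullet> (A *v (S *v x))" for x
    by (simp add: symmetric_inner[OF SPD_sym[OF S]] matrix_vector_mul_assoc matrix_mul_assoc)
  then show ?thesis
    using step_lower_bound[OF A eta] step_upper_bound[OF A eta] SPD_sym[OF SPD_congruence[OF SA S]]
    by (simp add: cov_box_def S_def)
qed

section \<open>The minimiser\<close>

text \<open>
A nonzero gradient would make a sufficiently short step strictly decreasing.
\<close>

lemma grad_minimizer_eq_0:
  assumes A: "A \<in> SPD" and min: "\<And>B. B \<in> SPD \<Longrightarrow> F A \<le> F B"
  shows "grad A = 0"
proof -
  define G where "G = grad A"
  define e where "e = trace (G ** A ** G)"
  define K where "K = (1 + \<gamma>) / 2 * e + 2 * \<gamma> * (norm G)\<^sup>2"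
  obtain c where c: "0 < c" "\<And>x. c * (x \<bullet> x) \<le> x \<bullet> (A *v x)"
    by (rule SPD_lower_bound[OF A]) (rule that)
  have ce: "c * (norm G)\<^sup>2 \<le> e" unfolding G_def e_def by (rule energy_ge[OF A c(2)])
  then have e0: "0 \<le> e" using c(1) by (meson order_trans mult_nonneg_nonneg less_imp_le zero_le_power2)
  have K0: "0 \<le> K" using e0 gamma_pos by (simp add: K_def)
  have step: "e \<le> \<eta> * K" if "0 < \<eta>" "\<eta> * (1 + \<gamma>) \<le> 1 / 2" for \<eta>
  proof -
    let ?S = "mat 1 - \<eta> *\<^sub>R grad A"
    have "?S ** A ** ?S \<in> SPD"
      using that by (intro SPD_congruence A step_factor_SPD) auto
    then have "F A \<le> F (?S ** A ** ?S)" by (rule min)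
    also have "\<dots> \<le> F A - \<eta> * e + \<eta>\<^sup>2 * K"
      using descent[OF A, of \<eta>] that by (simp add: e_def K_def G_def)
    finally have "\<eta> * e \<le> \<eta> * (\<eta> * K)" by (simp add: power2_eq_square mult.assoc)
    then show ?thesis using that(1) by simp
  qed
  have "e \<le> 0"
  proof (rule ccontr)
    assume "\<not> e \<le> 0"
    then have e: "0 < e" by simp
    define \<eta> where "\<eta> = min (1 / (2 * (1 + \<gamma>))) (e / (2 * (K + 1)))"
    have "0 < \<eta>" using e K0 gamma_pos by (simp add: \<eta>_def)
    have "\<eta> * (1 + \<gamma>) \<le> 1 / (2 * (1 + \<gamma>)) * (1 + \<gamma>)"
      using gamma_pos by (intro mult_right_mono) (auto simp: \<eta>_def)
    also have "1 / (2 * (1 + \<gamma>)) * (1 + \<gamma>) = 1 / 2" using gamma_pos by (simp add: field_simps)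
    finally have "e \<le> \<eta> * K" by (rule step[OF \<open>0 < \<eta>\<close>])
    also have "\<dots> \<le> e / (2 * (K + 1)) * K" using K0 by (intro mult_right_mono) (auto simp: \<eta>_def)
    also have "\<dots> = e / 2 * (K / (K + 1))" by simp
    also have "\<dots> \<le> e / 2 * 1" using e K0 by (intro mult_left_mono) auto
    finally show False using e by simp
  qed
  then have "c * (norm G)\<^sup>2 \<le> 0" using ce by simp
  then show ?thesis using c(1) by (simp add: mult_le_0_iff G_def)
qed

text \<open>
Evaluate \<open>M + \<gamma> A\<inverse> = (1 + \<gamma>) I\<close> at an eigenvector of \<open>A\<close> with eigenvalue \<open>l\<close>.  If \<open>l\<close> is the
smallest eigenvalue and \<open>l < 1/k\<close>, then both terms on the left are too large; if \<open>l > k\<close>, then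
both are too small.
\<close>

lemma critical_point_in_box:
  assumes A: "A \<in> SPD" and crit: "grad A = 0"
  shows "A \<in> cov_box k"
proof -
  have M: "mean_transport A = (1 + \<gamma>) *\<^sub>R mat 1 - \<gamma> *\<^sub>R matrix_inv A"
    using crit by (simp add: grad_def algebra_simps)
  have inv_e: "matrix_inv A *v e = (1 / l) *\<^sub>R e" "0 < l" if "norm e = 1" "A *v e = l *\<^sub>R e" for e l
  proof -
    have "e \<noteq> 0" using that by auto
    from SPD_pos[OF A this] show "0 < l" using that by (simp add: norm_eq_1)
    have "l *\<^sub>R (matrix_inv A *v e) = e"
      using SPD_inv_vector(2)[OF A, of e] that by (simp add: matvec.scaleR_right)
    then have "(1 / l) *\<^sub>R e = (1 / l) *\<^sub>R (l *\<^sub>R (matrix_inv A *v e))" by (simp only:)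
    then show "matrix_inv A *v e = (1 / l) *\<^sub>R e" using \<open>0 < l\<close> by simp
  qed
  have Me: "e \<bullet> (mean_transport A *v e) = 1 + \<gamma> - \<gamma> / l" if "norm e = 1" "A *v e = l *\<^sub>R e" for e l
    using that inv_e[OF that] by (simp add: M vec_expand norm_eq_1)
  obtain e l where e: "norm e = 1" "A *v e = l *\<^sub>R e"
    and l: "\<And>y. l * (y \<bullet> y) \<le> y \<bullet> (A *v y)"
    by (rule min_eigenvector[OF SPD_sym[OF A]]) (rule that)
  have "1 / k \<le> l"
  proof (rule ccontr)
    assume less: "\<not> 1 / k \<le> l"
    note l0 = inv_e(2)[OF e]
    have kl: "k * l < 1" using less k_pos by (simp add: field_simps)
    have "l < 1" using kl k_ge_1 l0 by (smt (verit) mult_le_cancel_right1)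
    have "1 < sqrt (l / k) * (1 / l)"
    proof -
      have "(sqrt (l / k) * (1 / l))\<^sup>2 = 1 / (k * l)"
        using l0 k_pos by (simp add: power_mult_distrib power_divide power2_eq_square field_simps)
      also have "1 < \<dots>" using kl k_pos l0 by simp
      finally have "1\<^sup>2 < (sqrt (l / k) * (1 / l))\<^sup>2" by simp
      then show ?thesis by (rule power2_less_imp_less) (use l0 k_pos in simp)
    qed
    also have "\<dots> = sqrt (l / k) * (e \<bullet> (matrix_inv A *v e))"
      using inv_e(1)[OF e] e(1) by (simp add: norm_eq_1)
    also have "\<dots> \<le> e \<bullet> (mean_transport A *v e)"
      by (rule mean_transport_lower[OF A _ l]) (use l0 in simp)
    also have "\<dots> = 1 + \<gamma> - \<gamma> / l" by (rule Me[OF e])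
    finally have "\<gamma> / l < \<gamma>" by simp
    then show False using \<open>l < 1\<close> l0 gamma_pos by (simp add: field_simps)
  qed
  moreover obtain e' l' where e': "norm e' = 1" "A *v e' = l' *\<^sub>R e'"
    and l': "\<And>y. y \<bullet> (A *v y) \<le> l' * (y \<bullet> y)"
    by (rule max_eigenvector[OF SPD_sym[OF A]]) (rule that)
  have "l' \<le> k"
  proof (rule ccontr)
    assume less: "\<not> l' \<le> k"
    note l0 = inv_e(2)[OF e']
    have "1 + \<gamma> - \<gamma> / l' \<le> sqrt k / sqrt l'"
      unfolding Me[OF e', symmetric]
    proof (rule mean_transport_functional_le[OF A bounded_linear_form])
      fix B :: "real^'n^'n" assume B: "B \<in> cov_box k"
      have "e' \<bullet> (A *v (transport A B *v e')) \<le> sqrt l' * sqrt k"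
        using cov_box_upper[OF B, of e'] transport_energy[OF A cov_box_SPD[OF B k_pos], of e'] e' l0 k_pos
        by (intro SPD_form_cauchy_schwarz[OF A]) (auto simp: norm_eq_1)
      moreover have "e' \<bullet> (A *v (transport A B *v e')) = l' * (e' \<bullet> (transport A B *v e'))"
        using e'(2) by (simp add: symmetric_inner[OF SPD_sym[OF A], symmetric])
      ultimately have "e' \<bullet> (transport A B *v e') \<le> sqrt l' * sqrt k / l'"
        using l0 by (simp add: pos_le_divide_eq mult.commute)
      also have "\<dots> = sqrt k / sqrt l'"
        using mult_divide_mult_cancel_left[of "sqrt l'" "sqrt k" "sqrt l'"] l0 by simp
      finally show "e' \<bullet> (transport A B *v e') \<le> sqrt k / sqrt l'" .
    qed
    moreover have "sqrt k / sqrt l' < 1" using less l0 by simp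
    moreover have "\<gamma> / l' \<le> \<gamma>" using less k_ge_1 gamma_pos by (simp add: field_simps)
    ultimately show False by simp
  qed
  ultimately have "1 / k * (x \<bullet> x) \<le> l * (x \<bullet> x)" "l' * (x \<bullet> x) \<le> k * (x \<bullet> x)" for x :: "real^'n"
    by (simp_all only: mult_right_mono inner_ge_zero)
  then show ?thesis
    unfolding cov_box_def using l l' SPD_sym[OF A] by (blast intro: order_trans)
qed

section \<open>Strong convexity and linear convergence\<close>

text \<open>
The modulus comes from the transport part alone; the entropy contributes only convexity.
\<close>

lemma F_strongly_convex:
  assumes A: "A \<in> cov_box k" and A': "A' \<in> cov_box k"
  shows "F A + grad A \<bullet> (A' - A) / 2 + (norm (A' - A))\<^sup>2 / (8 * k ^ 6) \<le> F A'"
proof -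
  note S = cov_box_SPD[OF A k_pos] cov_box_SPD[OF A' k_pos]
  define d where "d = A' - A"
  define M where "M = mean_transport A"
  let ?L = "\<lambda>X. trace ((mat 1 - X) ** d)"
  have tr: "?L X = trace d - trace (d ** X)" for X
    by (simp add: mat_expand trace_mul_sym[of X])
  have int: "integrable P (\<lambda>B. ?L (transport A B))" "(\<integral>B. ?L (transport A B) \<partial>P) = ?L M"
    unfolding tr M_def
    using integral_transport_linear[OF S(1) bounded_linear_trace_mult, of d] by (simp_all add: prob_space)
  have "(\<integral>B. W2_sq A B \<partial>P) + ?L M + (norm d)\<^sup>2 / (4 * k ^ 6)
      = (\<integral>B. W2_sq A B + ?L (transport A B) + (norm d)\<^sup>2 / (4 * k ^ 6) \<partial>P)"
    using int integral_W2_sq(1)[OF S(1)] by (simp add: prob_space)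
  also have "\<dots> \<le> (\<integral>B. W2_sq A' B \<partial>P)"
  proof (rule integral_mono_AE)
    show "AE B in P. W2_sq A B + ?L (transport A B) + (norm d)\<^sup>2 / (4 * k ^ 6) \<le> W2_sq A' B"
      using AE_box unfolding d_def
      by eventually_elim (rule W2_sq_strongly_convex[OF A A' _ k_pos])
  qed (use int integral_W2_sq(1)[OF S(1)] integral_W2_sq(1)[OF S(2)] in auto)
  finally have W: "(\<integral>B. W2_sq A B \<partial>P) + ?L M + (norm d)\<^sup>2 / (4 * k ^ 6) \<le> (\<integral>B. W2_sq A' B \<partial>P)" .
  have "\<gamma> * (KL_std A + ?L (matrix_inv A) / 2) \<le> \<gamma> * KL_std A'"
    using KL_std_tangent[OF S] gamma_pos by (simp add: d_def)
  moreover have "(norm d)\<^sup>2 / (8 * k ^ 6) = (norm d)\<^sup>2 / (4 * k ^ 6) / 2" by simp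
  moreover have "grad A \<bullet> d = ?L M + \<gamma> * ?L (matrix_inv A)"
    unfolding inner_symmetric_eq_trace[OF grad_sym[OF S(1)]]
    by (simp add: grad_def M_def mat_expand algebra_simps)
  ultimately show ?thesis
    using W unfolding barycenter_functional_def d_def[symmetric] distrib_left by linarith
qed

text \<open>
Strong convexity bounds the gap by \<open>g d / 2 - d\<^sup>2 / (8 k\<^sup>6)\<close> with \<open>g\<close> the Frobenius norm of the gradient and
\<open>d\<close> the distance; it remains to maximise over \<open>d\<close>.
\<close>

lemma gradient_domination:
  assumes A: "A \<in> cov_box k" and A': "A' \<in> cov_box k"
  shows "2 / k ^ 7 * (F A - F A') \<le> trace (grad A ** A ** grad A)"
proof -
  define g where "g = norm (grad A)"
  define d where "d = norm (A' - A)"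
  define K where "K = k ^ 6"
  have K: "0 < K" using k_pos by (simp add: K_def)
  have "- (g * d) \<le> grad A \<bullet> (A' - A)"
    unfolding g_def d_def using Cauchy_Schwarz_ineq2[of "grad A" "A' - A"] by simp
  then have "F A - F A' \<le> g * d / 2 - d\<^sup>2 / (8 * K)"
    using F_strongly_convex[OF A A'] by (simp add: d_def K_def)
  also have "\<dots> = K * g\<^sup>2 / 2 - (d - 2 * K * g)\<^sup>2 / (8 * K)"
    using K by (simp add: field_simps power2_eq_square)
  also have "\<dots> \<le> K * g\<^sup>2 / 2" using K by simp
  finally have "2 / k ^ 7 * (F A - F A') \<le> 2 / k ^ 7 * (K * g\<^sup>2 / 2)"
    using k_pos by (intro mult_left_mono) auto
  also have "\<dots> = 1 / k * g\<^sup>2"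
    using k_pos by (simp add: K_def field_simps eval_nat_numeral)
  also have "\<dots> \<le> trace (grad A ** A ** grad A)"
    unfolding g_def by (rule energy_ge[OF cov_box_SPD[OF A k_pos] cov_box_lower[OF A]])
  finally show ?thesis .
qed

lemma step_contraction:
  assumes A: "A \<in> cov_box k" and A': "A' \<in> cov_box k"
    and eta: "0 \<le> \<eta>" "\<eta> * (1 + \<gamma>) \<le> 1 / 2" "\<eta> * k * (1 + 5 * \<gamma>) \<le> 1"
  defines "S \<equiv> mat 1 - \<eta> *\<^sub>R grad A"
  shows "F (S ** A ** S) - F A' \<le> (1 - \<eta> / k ^ 7) * (F A - F A')"
proof -
  note SA = cov_box_SPD[OF A k_pos]
  define e where "e = trace (grad A ** A ** grad A)"
  have "1 / k * (norm (grad A))\<^sup>2 \<le> e"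
    unfolding e_def by (rule energy_ge[OF SA cov_box_lower[OF A]])
  then have n: "(norm (grad A))\<^sup>2 \<le> k * e"
    using k_pos by (simp add: field_simps)
  have "0 \<le> k * e" using n zero_le_power2 by (rule order_trans[rotated])
  then have e0: "0 \<le> e" using k_pos by (simp add: zero_le_mult_iff)
  have "F (S ** A ** S)
      \<le> F A - \<eta> * e + \<eta>\<^sup>2 * ((1 + \<gamma>) / 2 * e + 2 * \<gamma> * (norm (grad A))\<^sup>2)"
    unfolding S_def e_def by (rule descent[OF SA eta(1,2)])
  also have "\<dots> \<le> F A - \<eta> * e + \<eta>\<^sup>2 * (k * ((1 + \<gamma>) / 2 * e) + 2 * \<gamma> * (k * e))"
  proof -
    have "1 * ((1 + \<gamma>) / 2 * e) \<le> k * ((1 + \<gamma>) / 2 * e)"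
      using k_ge_1 gamma_pos e0 by (intro mult_right_mono) auto
    then show ?thesis
      using n gamma_pos by (intro add_left_mono mult_left_mono add_mono) auto
  qed
  also have "\<dots> = F A - \<eta> * e + \<eta> / 2 * e * (\<eta> * k * (1 + 5 * \<gamma>))"
    by (simp add: field_simps power2_eq_square)
  also have "\<dots> \<le> F A - \<eta> * e + \<eta> / 2 * e * 1"
    using eta e0 by (intro add_left_mono mult_left_mono) auto
  also have "\<dots> = F A - \<eta> / 2 * e" by simp
  also have "\<dots> \<le> F A - \<eta> / 2 * (2 / k ^ 7 * (F A - F A'))"
    using gradient_domination[OF A A'] eta(1) unfolding e_def
    by (intro diff_left_mono mult_left_mono) auto
  finally show ?thesis by (simp add: algebra_simps diff_divide_distrib)
qed

end

lemma (in random_covariance) rgd_in_box: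
  assumes "A0 \<in> cov_box k" "0 \<le> \<eta>" "\<eta> * (1 + \<gamma>) \<le> 1 / 2"
  shows "rgd P \<gamma> \<eta> A0 t \<in> cov_box k"
  by (induction t) (simp_all add: assms Let_def rgd_factor_eq_grad step_in_box[OF _ assms(2,3)])

lemma (in random_covariance) rgd_linear_convergence:
  assumes A0: "A0 \<in> cov_box k" and A': "A' \<in> SPD" and min: "\<And>B. B \<in> SPD \<Longrightarrow> F A' \<le> F B"
    and eta: "0 \<le> \<eta>" "\<eta> * (1 + \<gamma>) \<le> 1 / 2" "\<eta> * k * (1 + 5 * \<gamma>) \<le> 1"
  shows "F (rgd P \<gamma> \<eta> A0 t) - F A' \<le> exp (- (\<eta> / k ^ 7 * real t)) * (F A0 - F A')"
proof (induction t)
  case (Suc t)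
  let ?A = "rgd P \<gamma> \<eta> A0 t"
  have box: "?A \<in> cov_box k" by (rule rgd_in_box[OF A0 eta(1,2)])
  have box': "A' \<in> cov_box k"
    by (rule critical_point_in_box[OF A' grad_minimizer_eq_0[OF A' min]])
  have "F (rgd P \<gamma> \<eta> A0 (Suc t)) - F A' \<le> (1 - \<eta> / k ^ 7) * (F ?A - F A')"
    using step_contraction[OF box box' eta] by (simp add: Let_def rgd_factor_eq_grad)
  also have "\<dots> \<le> exp (- (\<eta> / k ^ 7)) * (F ?A - F A')"
    using exp_ge_add_one_self[of "- (\<eta> / k ^ 7)"] min[OF cov_box_SPD[OF box k_pos]]
    by (intro mult_right_mono) auto
  also have "\<dots> \<le> exp (- (\<eta> / k ^ 7)) * (exp (- (\<eta> / k ^ 7 * real t)) * (F A0 - F A'))"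
    by (intro mult_left_mono Suc) simp
  also have "\<dots> = exp (- (\<eta> / k ^ 7 * real (Suc t))) * (F A0 - F A')"
    by (simp add: mult_exp_exp algebra_simps add_divide_distrib flip: mult.assoc)
  finally show ?case .
qed simp

theorem theorem4:
  fixes P :: "(real^'n^'n) measure"
    and \<gamma> \<kappa> \<eta> :: real
    and \<Sigma>0 \<Sigma>star :: "real^'n^'n"
    and T :: nat
  assumes "\<gamma> > 0" and "\<kappa> \<ge> 1"
    and "prob_space P"
    and "sets P = sets (restrict_space borel SPD)"
    and "\<And>A l. A \<in> measure_support P \<Longrightarrow> eigenvalue A l \<Longrightarrow> l \<in> {1 / sqrt \<kappa> .. sqrt \<kappa>}"
    and "is_arg_min (barycenter_functional P \<gamma>) (\<lambda>A. A \<in> SPD) \<Sigma>star"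
    and "\<Sigma>0 \<in> measure_support P"
    and "\<eta> = 2 / ((2 + \<gamma>) ^ 4 * \<kappa>)"
    and "T \<ge> 1"
  shows "barycenter_functional P \<gamma> (rgd P \<gamma> \<eta> \<Sigma>0 T) - barycenter_functional P \<gamma> \<Sigma>star
           \<le> exp (- (4 * real T / ((2 + \<gamma>) ^ 20 * \<kappa> ^ 5)))
              * (barycenter_functional P \<gamma> \<Sigma>0 - barycenter_functional P \<gamma> \<Sigma>star)"
proof -
  define k where "k = sqrt \<kappa>"
  have k: "1 \<le> k" and kk: "\<kappa> = k\<^sup>2" using assms(2) by (simp_all add: k_def)
  have sp: "space P = SPD"
    using sets_eq_imp_space_eq[OF assms(4)] by (simp add: space_restrict_space)
  have supp: "A \<in> cov_box k" if "A \<in> measure_support P" for A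
    using that assms(5)[OF that] sp
    by (intro cov_box_eigenvalues) (auto simp: k_def measure_support_def)
  interpret prob_space P by (rule assms(3))
  interpret random_covariance P k \<gamma>
  proof
    show "AE B in P. B \<in> cov_box k"
      using AE_measure_support[OF assms(4)] by eventually_elim (rule supp)
  qed (use assms(1,4) k in auto)
  have star: "\<Sigma>star \<in> SPD" and min: "\<And>B. B \<in> SPD \<Longrightarrow> F \<Sigma>star \<le> F B"
    using assms(6) by (auto simp: is_arg_min_def not_less)
  define g where "g = 2 + \<gamma>"
  have g: "2 \<le> g" using assms(1) by (simp add: g_def)
  \<comment> \<open>enough to absorb both \<open>2 (1 + 5 \<gamma>)\<close> and \<open>4 (1 + \<gamma>)\<close> below\<close>
  have g4: "16 + 32 * \<gamma> \<le> g ^ 4"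
  proof -
    have "16 + 32 * \<gamma> \<le> (4 + 4 * \<gamma>)\<^sup>2" by (simp add: power2_eq_square algebra_simps)
    also have "\<dots> \<le> (g\<^sup>2)\<^sup>2"
      using assms(1) by (intro power_mono) (simp_all add: g_def power2_eq_square algebra_simps)
    finally show ?thesis by simp
  qed
  have eta: "\<eta> = 2 / (g ^ 4 * k\<^sup>2)" by (simp add: assms(8) g_def kk)
  have eta0: "0 \<le> \<eta>" using g k by (simp add: eta)
  have etak: "\<eta> * k \<le> 2 / g ^ 4"
  proof -
    have "\<eta> * k = 2 / g ^ 4 * (1 / k)" using k by (simp add: eta power2_eq_square)
    also have "\<dots> \<le> 2 / g ^ 4 * 1" using k g by (intro mult_left_mono) auto
    finally show ?thesis by simp
  qed
  have c3: "\<eta> * k * (1 + 5 * \<gamma>) \<le> 1" and c2: "\<eta> * (1 + \<gamma>) \<le> 1 / 2"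
  proof -
    have "\<eta> * k * (1 + 5 * \<gamma>) \<le> 2 / g ^ 4 * (1 + 5 * \<gamma>)"
      using etak assms(1) by (intro mult_right_mono) auto
    also have "\<dots> \<le> 1"
      using g4 g assms(1) by (simp add: field_simps)
    finally show "\<eta> * k * (1 + 5 * \<gamma>) \<le> 1" .
    have "\<eta> * 1 \<le> \<eta> * k" using k eta0 by (intro mult_left_mono) auto
    then have "\<eta> * (1 + \<gamma>) \<le> 2 / g ^ 4 * (1 + \<gamma>)"
      using etak assms(1) by (intro mult_right_mono) auto
    also have "\<dots> \<le> 1 / 2"
      using g4 g assms(1) by (simp add: field_simps)
    finally show "\<eta> * (1 + \<gamma>) \<le> 1 / 2" .
  qed
  have "4 / (g ^ 20 * \<kappa> ^ 5) \<le> \<eta> / k ^ 7"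
  proof -
    have "g ^ 1 * k ^ 0 \<le> g ^ 16 * k ^ 1"
      using g k by (intro mult_mono power_increasing) auto
    then have "2 \<le> g ^ 16 * k" using g by simp
    then have "4 \<le> 2 * (g ^ 16 * k)" by linarith
    then have "4 / (g ^ 20 * k ^ 10) \<le> 2 * (g ^ 16 * k) / (g ^ 20 * k ^ 10)"
      by (rule divide_right_mono) (use g k in simp)
    also have "\<dots> = 2 / (g ^ 4 * k ^ 9)"
      using g k by (simp add: eval_nat_numeral)
    also have "\<dots> = \<eta> / k ^ 7"
      by (simp add: eta eval_nat_numeral)
    finally show ?thesis by (simp add: kk flip: power_mult)
  qed
  then have "4 / (g ^ 20 * \<kappa> ^ 5) * real T \<le> \<eta> / k ^ 7 * real T"
    by (intro mult_right_mono) auto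
  then have rate: "exp (- (\<eta> / k ^ 7 * real T)) \<le> exp (- (4 * real T / (g ^ 20 * \<kappa> ^ 5)))"
    by simp
  have A0: "\<Sigma>0 \<in> cov_box k" by (rule supp[OF assms(7)])
  have "F (rgd P \<gamma> \<eta> \<Sigma>0 T) - F \<Sigma>star \<le> exp (- (\<eta> / k ^ 7 * real T)) * (F \<Sigma>0 - F \<Sigma>star)"
    by (rule rgd_linear_convergence[OF A0 star min eta0 c2 c3])
  also have "\<dots> \<le> exp (- (4 * real T / (g ^ 20 * \<kappa> ^ 5))) * (F \<Sigma>0 - F \<Sigma>star)"
    using rate min[OF cov_box_SPD[OF A0 k_pos]] by (intro mult_right_mono) auto
  finally show ?thesis by (simp add: g_def)
qed

end
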